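(* Let $n\ge1$, let $a=(a_1,\dots,a_n)$ with $a_1,\dots,a_n>0$, and let $\Delta_a=\sum_{j=1}^na_jD_j$. Then $\Lambda_p(a)<\infty$ for every $1\le p<\infty$, and for every $1\le p<\infty$, every Banach space $X$ and every $g:\Omega_n\to X$, $$\left(\mathbb E_{\varepsilon,\delta}\left\|\sum_{j=1}^n\delta_j\,a_j\Delta_a^{-1}D_jg(\varepsilon)\right\|_X^p\right)^{1/p}\le\Lambda_p(a)\,\|g\|_{L^p(\Omega_n;X)} .$$ Moreover, if $1\le p\le2$, then $$\Lambda_p(a)\le\Lambda_2(a)=\int_0^\infty\left(\sum_{j=1}^n\frac{a_j^2}{e^{2a_jt}-1}\right)^{1/2}dt .$$ In particular, if $a_1=\cdots=a_n$, then $\Lambda_2(a)=\frac{\pi}{2}\sqrt n$.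
   Context: $\Omega_n=\{-1,1\}^n$ carries the uniform probability measure; $\varepsilon$ denotes a uniformly distributed point of $\Omega_n$, and $\delta=(\delta_1,\dots,\delta_n)$ is a vector of independent symmetric random signs, independent of all other random variables. For $A\subseteq\{1,\dots,n\}$ put $W_A(\varepsilon)=\prod_{j\in A}\varepsilon_j$, $W_\varnothing\equiv1$. Every $f:\Omega_n\to X$ has the expansion $f=\sum_A\widehat f(A)W_A$ with $\widehat f(A)=\mathbb E_\varepsilon W_A(\varepsilon)f(\varepsilon)\in X$. Operators on $X$-valued functions are defined by their action on Walsh characters: $D_jW_A=\mathbf 1_{\{j\in A\}}W_A$; $\Delta_aW_A=a(A)W_A$ with $a(A)=\sum_{j\in A}a_j$; $\Delta_a^{-1}W_A=a(A)^{-1}W_A$ for $A\neq\varnothing$ and $\Delta_a^{-1}W_\varnothing=0$. The norm is $\|g\|_{L^p(\Omega_n;X)}=(\mathbb E_\varepsilon\|g(\varepsilon)\|_X^p)^{1/p}$. For $t>0$ let $\xi^a_1(t),\dots,\xi^a_n(t)$ be independent random signs, independent of $\delta$, with $\mathbb P\{\xi^a_j(t)=1\}=\frac{1+e^{-a_jt}}2$ and $\mathbb P\{\xi^a_j(t)=-1\}=\frac{1-e^{-a_jt}}2$, and put $$Z_j^a(t)=\frac{\xi_j^a(t)-e^{-a_jt}}{\sqrt{1-e^{-2a_jt}}}.$$ For $1\le p<\infty$ define $$\Lambda_p(a)=\int_0^\infty\left(\mathbb E_{\delta,\xi}\left|\sum_{j=1}^n\delta_j\frac{a_je^{-a_jt}}{\sqrt{1-e^{-2a_jt}}}Z_j^a(t)\right|^p\right)^{1/p}dt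 .$$ *)

theory Defs
  imports "HOL-Probability.Probability" "HOL-Probability.Product_PMF"
begin

section \<open>Walsh analysis on the discrete cube\<close>

text \<open>Points of the cube are functions on \<open>{1..n}\<close>, extended by \<open>undefined\<close>; only the values on
  \<open>Omega n\<close> of a function on the cube matter.\<close>

definition Omega :: "nat \<Rightarrow> (nat \<Rightarrow> real) set" where
  "Omega n = {1..n} \<rightarrow>\<^sub>E {-1, 1}"

definition walsh :: "nat set \<Rightarrow> (nat \<Rightarrow> real) \<Rightarrow> real" where
  "walsh A \<epsilon> = (\<Prod>j\<in>A. \<epsilon> j)"

text \<open>The expectation of a vector-valued function is written as a finite average, because the
  Bochner integral of the library is restricted to second-countable spaces.\<close>

definition walsh_coeff :: "nat \<Rightarrow> ((nat \<Rightarrow> real) \<Rightarrow> 'x::real_vector) \<Rightarrow> nat set \<Rightarrow> 'x" where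
  "walsh_coeff n f A = (\<Sum>\<epsilon>\<in>Omega n. walsh A \<epsilon> *\<^sub>R f \<epsilon>) /\<^sub>R real (card (Omega n))"

text \<open>The linear operator with \<open>W\<^sub>A \<mapsto> m A W\<^sub>A\<close>; see \<open>walsh_multiplier_walsh\<close> below.\<close>

definition walsh_multiplier ::
    "nat \<Rightarrow> (nat set \<Rightarrow> real) \<Rightarrow> ((nat \<Rightarrow> real) \<Rightarrow> 'x::real_vector) \<Rightarrow> (nat \<Rightarrow> real) \<Rightarrow> 'x" where
  "walsh_multiplier n m f = (\<lambda>\<epsilon>. \<Sum>A\<in>Pow {1..n}. (m A * walsh A \<epsilon>) *\<^sub>R walsh_coeff n f A)"

definition D_op :: "nat \<Rightarrow> nat \<Rightarrow> ((nat \<Rightarrow> real) \<Rightarrow> 'x::real_vector) \<Rightarrow> (nat \<Rightarrow> real) \<Rightarrow> 'x" where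
  "D_op n j = walsh_multiplier n (\<lambda>A. of_bool (j \<in> A))"

definition Delta_op ::
    "nat \<Rightarrow> (nat \<Rightarrow> real) \<Rightarrow> ((nat \<Rightarrow> real) \<Rightarrow> 'x::real_vector) \<Rightarrow> (nat \<Rightarrow> real) \<Rightarrow> 'x" where
  "Delta_op n a f = (\<lambda>\<epsilon>. \<Sum>j\<in>{1..n}. a j *\<^sub>R D_op n j f \<epsilon>)"

text \<open>The inverse of \<open>Delta_op n a\<close> on mean-zero functions, extended by zero to constants.\<close>

definition Delta_inv ::
    "nat \<Rightarrow> (nat \<Rightarrow> real) \<Rightarrow> ((nat \<Rightarrow> real) \<Rightarrow> 'x::real_vector) \<Rightarrow> (nat \<Rightarrow> real) \<Rightarrow> 'x" where
  "Delta_inv n a = walsh_multiplier n (\<lambda>A. if A = {} then 0 else inverse (\<Sum>j\<in>A. a j))"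

definition Lp_norm :: "nat \<Rightarrow> real \<Rightarrow> ((nat \<Rightarrow> real) \<Rightarrow> 'x::real_normed_vector) \<Rightarrow> real" where
  "Lp_norm n p g =
     (measure_pmf.expectation (pmf_of_set (Omega n)) (\<lambda>\<epsilon>. norm (g \<epsilon>) powr p)) powr (1 / p)"


section \<open>Random signs and the constant\<close>

text \<open>The law of a random sign with mean \<open>m\<close>, for \<open>-1 \<le> m \<le> 1\<close>.\<close>

definition sign_pmf :: "real \<Rightarrow> real pmf" where
  "sign_pmf m = map_pmf (\<lambda>b. if b then 1 else -1) (bernoulli_pmf ((1 + m) / 2))"

definition rademacher_pmf :: "nat \<Rightarrow> (nat \<Rightarrow> real) pmf" where
  "rademacher_pmf n = Pi_pmf {1..n} undefined (\<lambda>j. sign_pmf 0)"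

definition xi_pmf :: "nat \<Rightarrow> (nat \<Rightarrow> real) \<Rightarrow> real \<Rightarrow> (nat \<Rightarrow> real) pmf" where
  "xi_pmf n a t = Pi_pmf {1..n} undefined (\<lambda>j. sign_pmf (exp (- a j * t)))"

text \<open>\<open>Z a t j x\<close> is the normalization of the value \<open>x\<close> of the \<open>j\<close>-th sign at time \<open>t\<close>.\<close>

definition Z :: "(nat \<Rightarrow> real) \<Rightarrow> real \<Rightarrow> nat \<Rightarrow> real \<Rightarrow> real" where
  "Z a t j x = (x - exp (- a j * t)) / sqrt (1 - exp (- 2 * a j * t))"

definition Lambda :: "nat \<Rightarrow> real \<Rightarrow> (nat \<Rightarrow> real) \<Rightarrow> ennreal" where
  "Lambda n p a = (\<integral>\<^sup>+t\<in>{0<..}. ennreal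
     ((measure_pmf.expectation (pair_pmf (rademacher_pmf n) (xi_pmf n a t))
        (\<lambda>(\<delta>, \<xi>). \<bar>\<Sum>j\<in>{1..n}.
            \<delta> j * (a j * exp (- a j * t) / sqrt (1 - exp (- 2 * a j * t))) * Z a t j (\<xi> j)\<bar> powr p))
      powr (1 / p)) \<partial>lborel)"


section \<open>The operators act on Walsh functions as prescribed\<close>

lemma finite_Omega [simp]: "finite (Omega n)"
  by (auto simp: Omega_def intro!: finite_PiE)

lemma card_Omega: "card (Omega n) = 2 ^ n"
  by (simp add: Omega_def card_PiE numeral_2_eq_2)

lemma sum_walsh_mult:
  assumes "A \<subseteq> {1..n}" "B \<subseteq> {1..n}"
  shows "(\<Sum>\<epsilon>\<in>Omega n. walsh A \<epsilon> * walsh B \<epsilon>) = (if A = B then 2 ^ n else 0)"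
proof -
  define h :: "nat \<Rightarrow> real \<Rightarrow> real" where
    "h j x = (if j \<in> A then x else 1) * (if j \<in> B then x else 1)" for j x
  have W: "walsh C \<epsilon> = (\<Prod>j\<in>{1..n}. if j \<in> C then \<epsilon> j else 1)" if "C \<subseteq> {1..n}" for C \<epsilon>
    using that by (simp add: walsh_def prod.If_cases Int_absorb1)
  have "(\<Sum>\<epsilon>\<in>Omega n. walsh A \<epsilon> * walsh B \<epsilon>) = (\<Sum>\<epsilon>\<in>Omega n. \<Prod>j\<in>{1..n}. h j (\<epsilon> j))"
    unfolding W [OF assms(1)] W [OF assms(2)] h_def prod.distrib ..
  also have "\<dots> = (\<Prod>j\<in>{1..n}. \<Sum>x\<in>{-1, 1}. h j x)"
    unfolding Omega_def by (rule prod_sum_PiE [symmetric]) auto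
  also have "\<dots> = (\<Prod>j\<in>{1..n}. if j \<in> A \<longleftrightarrow> j \<in> B then 2 else 0)"
    by (rule prod.cong) (auto simp: h_def)
  also have "\<dots> = (if A = B then 2 ^ n else 0)"
  proof (cases "A = B")
    case False
    then obtain j where "j \<in> {1..n}" "(j \<in> A) \<noteq> (j \<in> B)" using assms by blast
    then have "\<exists>j\<in>{1..n}. (if j \<in> A \<longleftrightarrow> j \<in> B then 2 else 0) = (0::real)" by auto
    then show ?thesis using False by (simp only: prod_zero finite_atLeastAtMost) simp
  qed simp
  finally show ?thesis .
qed

lemma walsh_coeff_walsh:
  assumes "A \<subseteq> {1..n}" "B \<subseteq> {1..n}"
  shows "walsh_coeff n (\<lambda>\<epsilon>. walsh B \<epsilon> *\<^sub>R x) A = (if A = B then x else 0)"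
proof -
  have "walsh_coeff n (\<lambda>\<epsilon>. walsh B \<epsilon> *\<^sub>R x) A
      = ((\<Sum>\<epsilon>\<in>Omega n. walsh A \<epsilon> * walsh B \<epsilon>) / 2 ^ n) *\<^sub>R x"
    by (simp add: walsh_coeff_def card_Omega divide_inverse scaleR_sum_left [symmetric] mult.commute)
  then show ?thesis using sum_walsh_mult [OF assms] by simp
qed

lemma walsh_multiplier_walsh:
  assumes "B \<subseteq> {1..n}"
  shows "walsh_multiplier n m (\<lambda>\<epsilon>. walsh B \<epsilon> *\<^sub>R x) = (\<lambda>\<epsilon>. (m B * walsh B \<epsilon>) *\<^sub>R x)"
proof
  fix \<epsilon>
  have "walsh_multiplier n m (\<lambda>\<epsilon>. walsh B \<epsilon> *\<^sub>R x) \<epsilon>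
      = (\<Sum>A\<in>Pow {1..n}. if A = B then (m B * walsh B \<epsilon>) *\<^sub>R x else 0)"
    unfolding walsh_multiplier_def
    using walsh_coeff_walsh [OF _ assms, where x = x] by (intro sum.cong refl) simp
  then show "walsh_multiplier n m (\<lambda>\<epsilon>. walsh B \<epsilon> *\<^sub>R x) \<epsilon> = (m B * walsh B \<epsilon>) *\<^sub>R x"
    using assms by simp
qed

lemma D_op_walsh:
  assumes "B \<subseteq> {1..n}"
  shows "D_op n j (\<lambda>\<epsilon>. walsh B \<epsilon> *\<^sub>R x) = (\<lambda>\<epsilon>. if j \<in> B then walsh B \<epsilon> *\<^sub>R x else 0)"
  unfolding D_op_def walsh_multiplier_walsh [OF assms] by auto

lemma Delta_op_walsh:
  assumes "B \<subseteq> {1..n}"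
  shows "Delta_op n a (\<lambda>\<epsilon>. walsh B \<epsilon> *\<^sub>R x) = (\<lambda>\<epsilon>. (\<Sum>j\<in>B. a j) *\<^sub>R walsh B \<epsilon> *\<^sub>R x)"
proof
  fix \<epsilon>
  have "Delta_op n a (\<lambda>\<epsilon>. walsh B \<epsilon> *\<^sub>R x) \<epsilon>
      = (\<Sum>j\<in>{1..n}. if j \<in> B then a j *\<^sub>R walsh B \<epsilon> *\<^sub>R x else 0)"
    unfolding Delta_op_def D_op_walsh [OF assms] by (rule sum.cong) auto
  also have "\<dots> = (\<Sum>j\<in>B. a j *\<^sub>R walsh B \<epsilon> *\<^sub>R x)"
    using assms by (simp add: sum.If_cases Int_absorb1)
  finally show "Delta_op n a (\<lambda>\<epsilon>. walsh B \<epsilon> *\<^sub>R x) \<epsilon> = (\<Sum>j\<in>B. a j) *\<^sub>R walsh B \<epsilon> *\<^sub>R x"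
    by (simp only: scaleR_sum_left)
qed

lemma Delta_inv_walsh:
  assumes "B \<subseteq> {1..n}"
  shows "Delta_inv n a (\<lambda>\<epsilon>. walsh B \<epsilon> *\<^sub>R x)
    = (\<lambda>\<epsilon>. if B = {} then 0 else inverse (\<Sum>j\<in>B. a j) *\<^sub>R walsh B \<epsilon> *\<^sub>R x)"
  unfolding Delta_inv_def walsh_multiplier_walsh [OF assms] by auto

end

theory Submission
  imports Defs
begin

text \<open>The Riesz transforms are integrated along the heat semigroup \<open>exp (- t \<Delta>)\<close> of \<open>\<Delta> = \<Delta>\<^sub>a\<close>:
  \<open>\<Sum>\<^sub>j \<delta>\<^sub>j a\<^sub>j \<Delta>\<^sup>-\<^sup>1 D\<^sub>j g\<close> is the integral of \<open>\<Sum>\<^sub>j \<delta>\<^sub>j a\<^sub>j D\<^sub>j exp (- t \<Delta>) g\<close> over \<open>0 < t < \<infinity>\<close>.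
  The semigroup is an average, \<open>exp (- t \<Delta>) g(\<epsilon>) = E\<^sub>\<xi> g(\<epsilon>\<xi>)\<close>, over independent signs \<open>\<xi>\<^sub>j\<close> with means \<open>exp (- a\<^sub>j t)\<close>.
  The derivative \<open>a\<^sub>j D\<^sub>j\<close> can be moved from \<open>g\<close> to the law of \<open>\<xi>\<close>, where it becomes multiplication by a score
  \<open>b\<^sub>j(\<xi>\<^sub>j)\<close> with mean zero, which is exactly the multiple of \<open>Z\<^sub>j\<close> in the definition of \<open>Lambda\<close>. Hence
  \<open>\<Sum>\<^sub>j \<delta>\<^sub>j a\<^sub>j D\<^sub>j exp (- t \<Delta>) g(\<epsilon>) = E\<^sub>\<xi> S(\<delta>, \<xi>) g(\<epsilon>\<xi>)\<close> with \<open>S = \<Sum>\<^sub>j \<delta>\<^sub>j b\<^sub>j(\<xi>\<^sub>j)\<close> (\<open>heat_gradient_eq_average\<close>).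
  This separates the vector-valued function from a scalar random variable, so that only the triangle
  inequality is asked of the norm of the Banach space: Jensen's inequality over \<open>\<xi>\<close> and the invariance
  of the uniform measure under \<open>\<epsilon> \<mapsto> \<epsilon>\<xi>\<close> bound the \<open>L\<^sup>p\<close> norm at time \<open>t\<close> by the \<open>L\<^sup>p\<close> norm of \<open>S\<close>
  times that of \<open>g\<close> (\<open>heat_gradient_Lp_le\<close>),
  and Minkowski's integral inequality over \<open>t\<close> produces \<open>Lambda\<close> (\<open>Minkowski_integral\<close>,
  \<open>Riesz_transform_bound\<close>). The integral over \<open>t\<close> is handled through an explicit primitive of a sum of
  exponentials and the fundamental theorem of calculus on \<open>[0, T]\<close>.

  For finiteness, the \<open>L\<^sup>p\<close> norm of one score is at most \<open>a m (1 - m) powr (1/p - 1)\<close> with \<open>m = exp (- a t)\<close>,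
  and the integral of this over \<open>t\<close> is \<open>p\<close> (\<open>score_moment_le\<close>, \<open>nn_integral_score_bound\<close>). Monotonicity in \<open>p\<close>
  holds for the integrand already. For \<open>p = 2\<close> the scores are orthogonal with second moment
  \<open>a\<^sub>j\<^sup>2 / (exp (2 a\<^sub>j t) - 1)\<close>, and for equal rates the resulting integral is elementary, with an arctangent as
  primitive.\<close>

section \<open>Weighted power means on a finite set\<close>

text \<open>Young's inequality applied termwise to the normalized functions. The second factor enters as
  \<open>y powr (p - 1)\<close> because that is the extremal function in the duality argument below; this form also
  covers \<open>p = 1\<close>, where the conjugate exponent is infinite.\<close>
lemma Hoelder_sum:
  fixes w x y :: "'i \<Rightarrow> real"
  assumes fin: "finite I" and p: "p \<ge> 1"
    and w: "\<And>i. i \<in> I \<Longrightarrow> w i \<ge> 0" and x: "\<And>i. i \<in> I \<Longrightarrow> x i \<ge> 0"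
    and y: "\<And>i. i \<in> I \<Longrightarrow> y i \<ge> 0"
  shows "(\<Sum>i\<in>I. w i * (x i * y i powr (p - 1)))
    \<le> (\<Sum>i\<in>I. w i * x i powr p) powr (1 / p) * (\<Sum>i\<in>I. w i * y i powr p) powr (1 - 1 / p)"
proof -
  define X where "X = (\<Sum>i\<in>I. w i * x i powr p)"
  define Y where "Y = (\<Sum>i\<in>I. w i * y i powr p)"
  have X0: "X \<ge> 0" and Y0: "Y \<ge> 0" unfolding X_def Y_def using w by (auto intro!: sum_nonneg)
  show ?thesis
  proof (cases "X = 0 \<or> Y = 0")
    case True
    \<comment> \<open>A vanishing factor on the right forces every term on the left to vanish, also for
      \<open>p = 1\<close>, since \<open>0 powr 0 = 0\<close>.\<close>
    have "w i * (x i * y i powr (p - 1)) = 0" if i: "i \<in> I" for i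
    proof -
      have "w i * x i powr p = 0 \<or> w i * y i powr p = 0"
        using True i fin w unfolding X_def Y_def
        by (subst (asm) (1 2) sum_nonneg_eq_0_iff) auto
      then show ?thesis by auto
    qed
    then have "(\<Sum>i\<in>I. w i * (x i * y i powr (p - 1))) = 0"
      by (intro sum.neutral ballI)
    then show ?thesis by (simp add: X_def [symmetric] Y_def [symmetric])
  next
    case False
    with X0 Y0 have XY: "X > 0" "Y > 0" by auto
    define C where "C = X powr (1 / p) * Y powr (1 - 1 / p)"
    have C: "C > 0" using XY by (simp add: C_def)
    have pointwise: "x i * y i powr (p - 1)
        \<le> C * (1 / p * (x i powr p / X) + (1 - 1 / p) * (y i powr p / Y))" if i: "i \<in> I" for i
    proof (cases "x i = 0 \<or> y i = 0")
      case True
      then have "x i * y i powr (p - 1) = 0" by auto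
      moreover have "0 \<le> C * (1 / p * (x i powr p / X) + (1 - 1 / p) * (y i powr p / Y))"
        using C XY p by (intro mult_nonneg_nonneg add_nonneg_nonneg) auto
      ultimately show ?thesis by (simp only:)
    next
      case False
      with x [OF i] y [OF i] have pos: "x i > 0" "y i > 0" by auto
      have "(x i powr p / X) powr (1 / p) * (y i powr p / Y) powr (1 - 1 / p)
          \<le> 1 / p * (x i powr p / X) + (1 - 1 / p) * (y i powr p / Y)"
        using p pos XY by (intro Youngs_inequality_0) (auto simp: field_simps)
      moreover have "p * (1 - 1 / p) = p - 1" using p by (simp add: field_simps)
      then have "(x i powr p / X) powr (1 / p) * (y i powr p / Y) powr (1 - 1 / p)
          = x i * y i powr (p - 1) / C"
        using p pos XY by (simp add: powr_divide powr_powr C_def)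
      ultimately show ?thesis using C by (simp add: divide_le_eq mult.commute)
    qed
    have "(\<Sum>i\<in>I. w i * (x i * y i powr (p - 1)))
        \<le> (\<Sum>i\<in>I. w i * (C * (1 / p * (x i powr p / X) + (1 - 1 / p) * (y i powr p / Y))))"
      using pointwise w by (intro sum_mono mult_left_mono) auto
    also have "\<dots> = (\<Sum>i\<in>I. C / (p * X) * (w i * x i powr p) + C * (1 - 1 / p) / Y * (w i * y i powr p))"
      by (intro sum.cong refl) (simp add: algebra_simps)
    also have "\<dots> = C / (p * X) * X + C * (1 - 1 / p) / Y * Y"
      unfolding sum.distrib sum_distrib_left [symmetric] X_def [symmetric] Y_def [symmetric] ..
    also have "\<dots> = C" using XY p by (simp add: field_simps)
    finally show ?thesis by (simp add: C_def X_def Y_def)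
  qed
qed

lemma weighted_mean_powr_le:
  fixes w x :: "'i \<Rightarrow> real"
  assumes fin: "finite I" and p: "p \<ge> 1"
    and w: "\<And>i. i \<in> I \<Longrightarrow> w i \<ge> 0" and x: "\<And>i. i \<in> I \<Longrightarrow> x i \<ge> 0"
    and one: "(\<Sum>i\<in>I. w i) = 1"
  shows "(\<Sum>i\<in>I. w i * x i) powr p \<le> (\<Sum>i\<in>I. w i * x i powr p)"
proof -
  have "(\<Sum>i\<in>I. w i * x i) \<le> (\<Sum>i\<in>I. w i * x i powr p) powr (1 / p)"
    using Hoelder_sum [OF fin p, of w x "\<lambda>_. 1"] w x one by simp
  then have "(\<Sum>i\<in>I. w i * x i) powr p \<le> ((\<Sum>i\<in>I. w i * x i powr p) powr (1 / p)) powr p"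
    using p w x by (intro powr_mono2) (auto intro!: sum_nonneg)
  also have "\<dots> = (\<Sum>i\<in>I. w i * x i powr p)"
    using p w by (simp add: powr_powr sum_nonneg)
  finally show ?thesis .
qed

text \<open>The \<open>L\<^sup>p\<close> norm of an integral is at most the integral of the \<open>L\<^sup>p\<close> norms. With
  \<open>S = \<Sum>i. w i * U i powr p\<close> for the norms \<open>U\<close> of the increments, split off one factor \<open>U i\<close> from
  \<open>U i powr p\<close>, estimate it by the integral of the norm of the derivative, and apply Hoelder's inequality at each time; dividing by
  \<open>S powr (1 - 1/p)\<close> gives the claim. Increments of an explicit primitive stand for the vector-valued
  integral, so that only norms of vectors are integrated.\<close>
lemma Minkowski_integral:
  fixes F F' :: "'i \<Rightarrow> real \<Rightarrow> 'x::banach"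
  assumes fin: "finite I" and p: "p \<ge> 1" and w: "\<And>i. i \<in> I \<Longrightarrow> w i \<ge> 0" and ab: "a \<le> b"
    and deriv: "\<And>i t. i \<in> I \<Longrightarrow> t \<in> {a..b} \<Longrightarrow>
      (F i has_vector_derivative F' i t) (at t within {a..b})"
    and cont: "\<And>i. i \<in> I \<Longrightarrow> continuous_on {a..b} (F' i)"
  shows "(\<Sum>i\<in>I. w i * norm (F i b - F i a) powr p) powr (1 / p)
    \<le> integral {a..b} (\<lambda>t. (\<Sum>i\<in>I. w i * norm (F' i t) powr p) powr (1 / p))"
proof -
  define U where "U i = norm (F i b - F i a)" for i
  define N where "N t = (\<Sum>i\<in>I. w i * norm (F' i t) powr p) powr (1 / p)" for t
  define S where "S = (\<Sum>i\<in>I. w i * U i powr p)"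
  have S0: "S \<ge> 0" unfolding S_def using w by (intro sum_nonneg) auto
  have contN: "continuous_on {a..b} N"
    unfolding N_def using cont p w
    by (intro continuous_on_powr' continuous_intros ballI) (auto simp: sum_nonneg)
  have U_le: "U i \<le> integral {a..b} (\<lambda>t. norm (F' i t))" if i: "i \<in> I" for i
  proof -
    have I: "(F' i has_integral (F i b - F i a)) {a..b}"
      using fundamental_theorem_of_calculus [OF ab deriv [OF i]] by blast
    have "norm (integral {a..b} (F' i)) \<le> integral {a..b} (\<lambda>t. norm (F' i t))"
      using I cont [OF i] by (intro integral_norm_bound_integral integrable_continuous_real
        continuous_intros) auto
    then show ?thesis using I by (simp add: U_def integral_unique)
  qed
  have "S = (\<Sum>i\<in>I. w i * (U i * U i powr (p - 1)))"
    unfolding S_def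
  proof (intro sum.cong refl)
    fix i
    show "w i * U i powr p = w i * (U i * U i powr (p - 1))"
      by (cases "U i = 0") (auto simp: U_def powr_diff)
  qed
  also have "\<dots> \<le> (\<Sum>i\<in>I. w i * (integral {a..b} (\<lambda>t. norm (F' i t)) * U i powr (p - 1)))"
    using U_le w by (intro sum_mono mult_left_mono mult_right_mono) auto
  also have "\<dots> = (\<Sum>i\<in>I. integral {a..b} (\<lambda>t. w i * (norm (F' i t) * U i powr (p - 1))))"
    by simp
  also have "\<dots> = integral {a..b} (\<lambda>t. \<Sum>i\<in>I. w i * (norm (F' i t) * U i powr (p - 1)))"
    using cont fin by (intro integral_sum [symmetric] integrable_continuous_real continuous_intros) auto
  also have "\<dots> \<le> integral {a..b} (\<lambda>t. N t * S powr (1 - 1 / p))"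
  proof (intro integral_le integrable_continuous_real continuous_intros contN)
    fix t
    show "(\<Sum>i\<in>I. w i * (norm (F' i t) * U i powr (p - 1))) \<le> N t * S powr (1 - 1 / p)"
      unfolding N_def S_def by (rule Hoelder_sum [OF fin p w]) (auto simp: U_def)
  qed (use cont in auto)
  finally have le: "S \<le> integral {a..b} N * S powr (1 - 1 / p)" by simp
  have N0: "integral {a..b} N \<ge> 0"
    by (intro integral_nonneg integrable_continuous_real contN) (simp add: N_def)
  have "S powr (1 / p) \<le> integral {a..b} N"
  proof (cases "S = 0")
    case False
    with S0 have S: "S > 0" by simp
    have "S powr (1 / p) * S powr (1 - 1 / p) = S" using S by (simp flip: powr_add)
    with le have "S powr (1 / p) * S powr (1 - 1 / p) \<le> integral {a..b} N * S powr (1 - 1 / p)"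
      by simp
    then show ?thesis using S by simp
  qed (use N0 in simp)
  then show ?thesis by (simp add: S_def U_def N_def [abs_def])
qed

section \<open>Biased signs and Walsh expansions on the cube\<close>

text \<open>The mass that the law of independent signs with means \<open>m j\<close> gives to a point of the cube; for
  \<open>m = 0\<close> it is the uniform mass. With it every expectation becomes a finite sum, which also makes sense
  for vector-valued functions.\<close>
definition sign_weight :: "nat \<Rightarrow> (nat \<Rightarrow> real) \<Rightarrow> (nat \<Rightarrow> real) \<Rightarrow> real" where
  "sign_weight n m \<xi> = (\<Prod>j\<in>{1..n}. (1 + m j * \<xi> j) / 2)"

lemma Omega_values: "\<xi> \<in> Omega n \<Longrightarrow> j \<in> {1..n} \<Longrightarrow> \<xi> j = -1 \<or> \<xi> j = 1"
  by (auto simp: Omega_def PiE_def Pi_def)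

lemma sign_weight_nonneg:
  assumes "\<And>j. j \<in> {1..n} \<Longrightarrow> \<bar>m j\<bar> \<le> 1" "\<xi> \<in> Omega n"
  shows "sign_weight n m \<xi> \<ge> 0"
  unfolding sign_weight_def
proof (intro prod_nonneg ballI)
  fix j assume "j \<in> {1..n}"
  then show "0 \<le> (1 + m j * \<xi> j) / 2" using assms(1) [of j] Omega_values [OF assms(2), of j] by auto
qed

lemma sign_weight_0: "sign_weight n (\<lambda>_. 0) \<xi> = 1 / 2 ^ n"
  by (simp add: sign_weight_def power_divide)

text \<open>Independence of the coordinates.\<close>
lemma sum_sign_weight_prod:
  "(\<Sum>\<xi>\<in>Omega n. sign_weight n m \<xi> * (\<Prod>j\<in>{1..n}. h j (\<xi> j)))
    = (\<Prod>j\<in>{1..n}. (1 + m j) / 2 * h j 1 + (1 - m j) / 2 * h j (-1))"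
proof -
  have "(\<Sum>\<xi>\<in>Omega n. sign_weight n m \<xi> * (\<Prod>j\<in>{1..n}. h j (\<xi> j)))
      = (\<Sum>\<xi>\<in>Omega n. \<Prod>j\<in>{1..n}. (1 + m j * \<xi> j) / 2 * h j (\<xi> j))"
    unfolding sign_weight_def prod.distrib [symmetric] ..
  also have "\<dots> = (\<Prod>j\<in>{1..n}. \<Sum>x\<in>{-1, 1}. (1 + m j * x) / 2 * h j x)"
    unfolding Omega_def by (rule prod_sum_PiE [symmetric]) auto
  also have "\<dots> = (\<Prod>j\<in>{1..n}. (1 + m j) / 2 * h j 1 + (1 - m j) / 2 * h j (-1))"
    by (intro prod.cong refl) simp
  finally show ?thesis .
qed

lemma sum_sign_weight: "(\<Sum>\<xi>\<in>Omega n. sign_weight n m \<xi>) = 1"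
  using sum_sign_weight_prod [of n m "\<lambda>_ _. 1"] by (simp add: field_simps)

lemma sum_sign_weight_coordinate:
  assumes "j \<in> {1..n}"
  shows "(\<Sum>\<xi>\<in>Omega n. sign_weight n m \<xi> * h (\<xi> j)) = (1 + m j) / 2 * h 1 + (1 - m j) / 2 * h (-1)"
proof -
  have "(\<Sum>\<xi>\<in>Omega n. sign_weight n m \<xi> * h (\<xi> j))
      = (\<Sum>\<xi>\<in>Omega n. sign_weight n m \<xi> * (\<Prod>k\<in>{1..n}. if k = j then h (\<xi> k) else 1))"
    using assms by simp
  also have "\<dots> = (\<Prod>k\<in>{1..n}. if k = j then (1 + m j) / 2 * h 1 + (1 - m j) / 2 * h (-1) else 1)"
    by (subst sum_sign_weight_prod) (intro prod.cong refl, auto simp: field_simps)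
  finally show ?thesis using assms by simp
qed

lemma pmf_sign_pmf:
  assumes "\<bar>m\<bar> \<le> 1" "x = -1 \<or> x = 1"
  shows "pmf (sign_pmf m) x = (1 + m * x) / 2"
proof -
  have inj: "inj (\<lambda>b. if b then 1 else -1 :: real)" by (auto simp: inj_def)
  have "pmf (sign_pmf m) (if b then 1 else -1) = pmf (bernoulli_pmf ((1 + m) / 2)) b" for b
    unfolding sign_pmf_def using pmf_map_inj' [OF inj] by simp
  from this [of True] this [of False] assms show ?thesis by (auto simp: field_simps)
qed

lemma set_sign_pmf: "set_pmf (sign_pmf m) \<subseteq> {-1, 1}"
  by (auto simp: sign_pmf_def)

lemma pmf_Pi_sign:
  assumes "\<And>j. j \<in> {1..n} \<Longrightarrow> \<bar>m j\<bar> \<le> 1" "\<xi> \<in> Omega n"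
  shows "pmf (Pi_pmf {1..n} undefined (\<lambda>j. sign_pmf (m j))) \<xi> = sign_weight n m \<xi>"
proof -
  have "\<xi> j = undefined" if "j \<notin> {1..n}" for j using assms(2) that by (auto simp: Omega_def PiE_def extensional_def)
  then have "pmf (Pi_pmf {1..n} undefined (\<lambda>j. sign_pmf (m j))) \<xi> = (\<Prod>j\<in>{1..n}. pmf (sign_pmf (m j)) (\<xi> j))"
    by (auto simp: pmf_Pi)
  also have "\<dots> = sign_weight n m \<xi>"
    unfolding sign_weight_def
    using assms Omega_values [OF assms(2)] by (intro prod.cong refl pmf_sign_pmf) auto
  finally show ?thesis .
qed

lemma set_Pi_sign: "set_pmf (Pi_pmf {1..n} undefined (\<lambda>j. sign_pmf (m j))) \<subseteq> Omega n"
  using set_sign_pmf by (fastforce simp: set_Pi_pmf PiE_dflt_def Omega_def PiE_def extensional_def)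

lemma expectation_pair_sum:
  fixes f :: "'a \<times> 'b \<Rightarrow> real"
  assumes "finite A" "finite B" "set_pmf M \<subseteq> A" "set_pmf N \<subseteq> B"
  shows "measure_pmf.expectation (pair_pmf M N) f = (\<Sum>x\<in>A. pmf M x * (\<Sum>y\<in>B. pmf N y * f (x, y)))"
proof -
  have "measure_pmf.expectation (pair_pmf M N) f = (\<Sum>z\<in>A \<times> B. f z * pmf (pair_pmf M N) z)"
    using assms by (intro integral_measure_pmf_real) auto
  also have "\<dots> = (\<Sum>x\<in>A. \<Sum>y\<in>B. f (x, y) * (pmf M x * pmf N y))"
    by (subst sum.cartesian_product) (auto simp: pmf_pair intro!: sum.cong)
  finally show ?thesis by (simp add: sum_distrib_left ac_simps)
qed

text \<open>Inversion formula: the kernel \<open>\<Sum>\<^sub>A W\<^sub>A(\<epsilon>) W\<^sub>A(\<eta>) = \<Prod>\<^sub>j (1 + \<epsilon>\<^sub>j \<eta>\<^sub>j)\<close> vanishes as soon as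
  one coordinate differs.\<close>
lemma walsh_expansion:
  assumes \<epsilon>: "\<epsilon> \<in> Omega n"
  shows "(\<Sum>A\<in>Pow {1..n}. walsh A \<epsilon> *\<^sub>R walsh_coeff n g A) = g \<epsilon>"
proof -
  have kernel: "(\<Sum>A\<in>Pow {1..n}. walsh A \<epsilon> * walsh A \<eta>) = (if \<eta> = \<epsilon> then 2 ^ n else 0)"
    if \<eta>: "\<eta> \<in> Omega n" for \<eta>
  proof -
    have "(\<Sum>A\<in>Pow {1..n}. walsh A \<epsilon> * walsh A \<eta>) = (\<Prod>j\<in>{1..n}. \<epsilon> j * \<eta> j + 1)"
      by (subst prod_add) (auto simp: walsh_def prod.distrib)
    also have "\<dots> = (if \<eta> = \<epsilon> then 2 ^ n else 0)"
    proof (cases "\<eta> = \<epsilon>")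
      case True
      have "(\<Prod>j\<in>{1..n}. \<epsilon> j * \<eta> j + 1) = (\<Prod>j\<in>{1..n}. 2)"
        using Omega_values [OF \<epsilon>] True by (intro prod.cong refl) fastforce
      then show ?thesis using True by simp
    next
      case False
      then obtain j where j: "j \<in> {1..n}" "\<eta> j \<noteq> \<epsilon> j"
        using \<epsilon> \<eta> unfolding Omega_def by (meson PiE_ext)
      then have "\<epsilon> j * \<eta> j + 1 = 0" using Omega_values [OF \<epsilon>, of j] Omega_values [OF \<eta>, of j] by auto
      then show ?thesis using False j by (subst prod_zero) auto
    qed
    finally show ?thesis .
  qed
  have "(\<Sum>A\<in>Pow {1..n}. walsh A \<epsilon> *\<^sub>R walsh_coeff n g A)
      = (\<Sum>A\<in>Pow {1..n}. \<Sum>\<eta>\<in>Omega n. ((walsh A \<epsilon> * walsh A \<eta>) / 2 ^ n) *\<^sub>R g \<eta>)"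
    by (simp add: walsh_coeff_def card_Omega scaleR_sum_right divide_inverse mult_ac)
  also have "\<dots> = (\<Sum>\<eta>\<in>Omega n. \<Sum>A\<in>Pow {1..n}. ((walsh A \<epsilon> * walsh A \<eta>) / 2 ^ n) *\<^sub>R g \<eta>)"
    by (rule sum.swap)
  also have "\<dots> = (\<Sum>\<eta>\<in>Omega n. ((\<Sum>A\<in>Pow {1..n}. walsh A \<epsilon> * walsh A \<eta>) / 2 ^ n) *\<^sub>R g \<eta>)"
    by (simp add: scaleR_sum_left sum_divide_distrib)
  also have "\<dots> = (\<Sum>\<eta>\<in>Omega n. if \<eta> = \<epsilon> then g \<eta> else 0)"
    by (intro sum.cong refl) (simp add: kernel del: One_nat_def)
  finally show ?thesis using \<epsilon> by simp
qed

lemma walsh_coeff_multiplier: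
  assumes "A \<subseteq> {1..n}"
  shows "walsh_coeff n (walsh_multiplier n m g) A = m A *\<^sub>R walsh_coeff n g A"
proof -
  have "walsh_coeff n (walsh_multiplier n m g) A
      = (\<Sum>\<epsilon>\<in>Omega n. \<Sum>B\<in>Pow {1..n}. (walsh A \<epsilon> * walsh B \<epsilon> * (m B / 2 ^ n)) *\<^sub>R walsh_coeff n g B)"
    unfolding walsh_coeff_def [of n "walsh_multiplier n m g"]
    by (simp add: walsh_multiplier_def card_Omega scaleR_sum_right divide_inverse mult_ac)
  also have "\<dots> = (\<Sum>B\<in>Pow {1..n}. \<Sum>\<epsilon>\<in>Omega n. (walsh A \<epsilon> * walsh B \<epsilon> * (m B / 2 ^ n)) *\<^sub>R walsh_coeff n g B)"
    by (rule sum.swap)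
  also have "\<dots> = (\<Sum>B\<in>Pow {1..n}. ((\<Sum>\<epsilon>\<in>Omega n. walsh A \<epsilon> * walsh B \<epsilon>) * (m B / 2 ^ n)) *\<^sub>R walsh_coeff n g B)"
    by (simp only: scaleR_sum_left sum_distrib_right)
  also have "\<dots> = (\<Sum>B\<in>Pow {1..n}. if A = B then m B *\<^sub>R walsh_coeff n g B else 0)"
    using assms by (intro sum.cong refl) (simp add: sum_walsh_mult)
  finally show ?thesis using assms by simp
qed

lemma Delta_inv_D_op:
  "Delta_inv n a (D_op n j g) \<epsilon>
    = (\<Sum>A\<in>Pow {1..n}. (of_bool (j \<in> A) / (\<Sum>k\<in>A. a k) * walsh A \<epsilon>) *\<^sub>R walsh_coeff n g A)"
  unfolding Delta_inv_def D_op_def walsh_multiplier_def [of n "\<lambda>A. if A = {} then 0 else inverse (\<Sum>j\<in>A. a j)"]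
  by (intro sum.cong refl) (auto simp: walsh_coeff_multiplier divide_inverse)

definition cube_mult :: "nat \<Rightarrow> (nat \<Rightarrow> real) \<Rightarrow> (nat \<Rightarrow> real) \<Rightarrow> nat \<Rightarrow> real" where
  "cube_mult n \<epsilon> \<xi> = (\<lambda>j\<in>{1..n}. \<epsilon> j * \<xi> j)"

lemma cube_mult_Omega: "\<epsilon> \<in> Omega n \<Longrightarrow> \<xi> \<in> Omega n \<Longrightarrow> cube_mult n \<epsilon> \<xi> \<in> Omega n"
  unfolding cube_mult_def Omega_def by (fastforce simp: PiE_def Pi_def)

lemma walsh_cube_mult: "A \<subseteq> {1..n} \<Longrightarrow> walsh A (cube_mult n \<epsilon> \<xi>) = walsh A \<epsilon> * walsh A \<xi>"
  unfolding walsh_def cube_mult_def prod.distrib [symmetric] by (intro prod.cong refl) auto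

text \<open>Invariance of the uniform measure: multiplication by a fixed sign vector is an involution of
  the cube.\<close>
lemma sum_cube_mult:
  assumes \<xi>: "\<xi> \<in> Omega n"
  shows "(\<Sum>\<epsilon>\<in>Omega n. h (cube_mult n \<epsilon> \<xi>)) = (\<Sum>\<epsilon>\<in>Omega n. h \<epsilon>)"
proof -
  have sq: "cube_mult n (cube_mult n \<epsilon> \<xi>) \<xi> = \<epsilon>" if "\<epsilon> \<in> Omega n" for \<epsilon>
  proof
    fix j
    show "cube_mult n (cube_mult n \<epsilon> \<xi>) \<xi> j = \<epsilon> j"
      using Omega_values [OF \<xi>, of j] that
      by (auto simp: cube_mult_def Omega_def PiE_def extensional_def)
  qed
  show ?thesis
    by (rule sum.reindex_bij_witness [where i = "\<lambda>\<epsilon>. cube_mult n \<epsilon> \<xi>" and j = "\<lambda>\<epsilon>. cube_mult n \<epsilon> \<xi>"])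
       (auto simp: sq cube_mult_Omega \<xi>)
qed

section \<open>The score representation of the heat semigroup\<close>

text \<open>The summand of the random sum in \<open>Lambda\<close> with its two square roots multiplied out. It equals
  \<open>- (d/dt) log \<rho>\<close>, where \<open>\<rho> = (1 + exp (- a j * t) * x) / 2\<close> is the mass that the \<open>j\<close>-th sign gives to \<open>x\<close> at
  time \<open>t\<close>; this is why averaging against it differentiates the semigroup in the \<open>j\<close>-th variable.\<close>
definition score :: "(nat \<Rightarrow> real) \<Rightarrow> real \<Rightarrow> nat \<Rightarrow> real \<Rightarrow> real" where
  "score a t j x = a j * exp (- a j * t) * (x - exp (- a j * t)) / (1 - (exp (- a j * t))\<^sup>2)"

definition score_sum :: "nat \<Rightarrow> (nat \<Rightarrow> real) \<Rightarrow> real \<Rightarrow> (nat \<Rightarrow> real) \<Rightarrow> (nat \<Rightarrow> real) \<Rightarrow> real" where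
  "score_sum n a t \<delta> \<xi> = (\<Sum>j\<in>{1..n}. \<delta> j * score a t j (\<xi> j))"

definition score_norm :: "nat \<Rightarrow> real \<Rightarrow> (nat \<Rightarrow> real) \<Rightarrow> real \<Rightarrow> real" where
  "score_norm n p a t = (\<Sum>\<delta>\<in>Omega n. 1 / 2 ^ n * (\<Sum>\<xi>\<in>Omega n.
     sign_weight n (\<lambda>j. exp (- a j * t)) \<xi> * \<bar>score_sum n a t \<delta> \<xi>\<bar> powr p)) powr (1 / p)"

lemma exp_neg_bounds:
  assumes "a > 0" "t > (0::real)"
  shows "0 < exp (- a * t)" "exp (- a * t) < 1" "(exp (- a * t))\<^sup>2 < 1" "exp (- 2 * a * t) = (exp (- a * t))\<^sup>2"
proof -
  show m: "0 < exp (- a * t)" "exp (- a * t) < 1" using assms by auto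
  then show "(exp (- a * t))\<^sup>2 < 1" by (simp add: power_less_one_iff)
  show "exp (- 2 * a * t) = (exp (- a * t))\<^sup>2" by (simp add: power2_eq_square exp_add [symmetric])
qed

lemma score_eq_Z:
  assumes "a j > 0" "t > 0"
  shows "a j * exp (- a j * t) / sqrt (1 - exp (- 2 * a j * t)) * Z a t j x = score a t j x"
proof -
  have "sqrt (1 - (exp (- a j * t))\<^sup>2) * sqrt (1 - (exp (- a j * t))\<^sup>2) = 1 - (exp (- a j * t))\<^sup>2"
    using exp_neg_bounds(3) [OF assms] by simp
  then show ?thesis unfolding Z_def score_def exp_neg_bounds(4) [OF assms] times_divide_times_eq
    by (simp only:)
qed

lemma Lambda_eq_score_norm:
  assumes a: "\<And>j. j \<in> {1..n} \<Longrightarrow> a j > 0"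
  shows "Lambda n p a = (\<integral>\<^sup>+t\<in>{0<..}. ennreal (score_norm n p a t) \<partial>lborel)"
  unfolding Lambda_def
proof (intro nn_integral_cong)
  fix t :: real
  show "ennreal ((measure_pmf.expectation (pair_pmf (rademacher_pmf n) (xi_pmf n a t))
        (\<lambda>(\<delta>, \<xi>). \<bar>\<Sum>j\<in>{1..n}.
            \<delta> j * (a j * exp (- a j * t) / sqrt (1 - exp (- 2 * a j * t))) * Z a t j (\<xi> j)\<bar> powr p))
      powr (1 / p)) * indicator {0<..} t = ennreal (score_norm n p a t) * indicator {0<..} t"
  proof (cases "t > 0")
    case True
    have m: "\<bar>exp (- a j * t)\<bar> \<le> 1" if "j \<in> {1..n}" for j
      using exp_neg_bounds(2) [OF a [OF that] True] by simp
    have S: "(\<Sum>j\<in>{1..n}. \<delta> j * (a j * exp (- a j * t) / sqrt (1 - exp (- 2 * a j * t))) * Z a t j (\<xi> j))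
        = score_sum n a t \<delta> \<xi>" for \<delta> \<xi>
      unfolding score_sum_def
    proof (intro sum.cong refl)
      fix j assume "j \<in> {1..n}"
      from score_eq_Z [of a, OF a [OF this] True]
      show "\<delta> j * (a j * exp (- a j * t) / sqrt (1 - exp (- 2 * a j * t))) * Z a t j (\<xi> j)
          = \<delta> j * score a t j (\<xi> j)"
        by (simp only: mult.assoc)
    qed
    have "measure_pmf.expectation (pair_pmf (rademacher_pmf n) (xi_pmf n a t))
        (\<lambda>(\<delta>, \<xi>). \<bar>score_sum n a t \<delta> \<xi>\<bar> powr p)
      = (\<Sum>\<delta>\<in>Omega n. pmf (rademacher_pmf n) \<delta> * (\<Sum>\<xi>\<in>Omega n.
          pmf (xi_pmf n a t) \<xi> * \<bar>score_sum n a t \<delta> \<xi>\<bar> powr p))"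
      unfolding rademacher_pmf_def xi_pmf_def
      by (subst expectation_pair_sum [OF _ _ set_Pi_sign set_Pi_sign]) auto
    also have "\<dots> = (\<Sum>\<delta>\<in>Omega n. 1 / 2 ^ n * (\<Sum>\<xi>\<in>Omega n.
          sign_weight n (\<lambda>j. exp (- a j * t)) \<xi> * \<bar>score_sum n a t \<delta> \<xi>\<bar> powr p))"
      unfolding rademacher_pmf_def xi_pmf_def
      using m by (intro sum.cong refl arg_cong2 [where f = "(*)"])
        (simp_all only: pmf_Pi_sign sign_weight_0 abs_zero zero_le_one)
    finally show ?thesis unfolding S score_norm_def by (simp only:)
  qed simp
qed

text \<open>The \<open>j\<close>-th coordinate contributes \<open>E (b\<^sub>j) = 0\<close> if \<open>j \<notin> A\<close> and \<open>E (b\<^sub>j \<xi>\<^sub>j) = a\<^sub>j exp (- a\<^sub>j t)\<close> if \<open>j \<in> A\<close>,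
  where \<open>b\<^sub>j\<close> is the score; every other coordinate \<open>k \<in> A\<close> contributes its mean
  \<open>exp (- a\<^sub>k t)\<close>. So correlating with the score acts on Walsh functions like \<open>a\<^sub>j D\<^sub>j\<close> composed with the heat
  semigroup.\<close>
lemma score_walsh_correlation:
  assumes a: "\<And>j. j \<in> {1..n} \<Longrightarrow> a j > 0" and t: "t > 0"
    and j: "j \<in> {1..n}" and A: "A \<subseteq> {1..n}"
  shows "(\<Sum>\<xi>\<in>Omega n. sign_weight n (\<lambda>j. exp (- a j * t)) \<xi> * (score a t j (\<xi> j) * walsh A \<xi>))
    = (if j \<in> A then a j * exp (- t * (\<Sum>k\<in>A. a k)) else 0)"
proof -
  define h where "h k x = (if k = j then score a t j x else 1) * (if k \<in> A then x else 1)" for k x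
  have fA: "finite A" using A finite_subset by blast
  have W: "walsh A \<xi> = (\<Prod>k\<in>{1..n}. if k \<in> A then \<xi> k else 1)" for \<xi>
    using A by (simp add: walsh_def prod.If_cases Int_absorb1)
  have "score a t j (\<xi> j) = (\<Prod>k\<in>{1..n}. if k = j then score a t j (\<xi> k) else 1)" for \<xi>
    using j by simp
  then have "score a t j (\<xi> j) * walsh A \<xi> = (\<Prod>k\<in>{1..n}. h k (\<xi> k))" for \<xi>
    unfolding h_def prod.distrib W by (simp only:)
  then have "(\<Sum>\<xi>\<in>Omega n. sign_weight n (\<lambda>j. exp (- a j * t)) \<xi> * (score a t j (\<xi> j) * walsh A \<xi>))
      = (\<Prod>k\<in>{1..n}. (1 + exp (- a k * t)) / 2 * h k 1 + (1 - exp (- a k * t)) / 2 * h k (-1))"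
    by (simp only: sum_sign_weight_prod)
  also have "\<dots> = (\<Prod>k\<in>{1..n}. (if k = j then if j \<in> A then a j else 0 else 1)
      * (if k \<in> A then exp (- a k * t) else 1))"
  proof (intro prod.cong refl)
    fix k
    define m where "m = exp (- a j * t)"
    have "1 - m\<^sup>2 > 0" using exp_neg_bounds(3) [OF a [OF j] t] by (simp add: m_def)
    then have "(1 + m) / 2 * (a j * m * (1 - m) / (1 - m\<^sup>2)) - (1 - m) / 2 * (a j * m * (-1 - m) / (1 - m\<^sup>2)) = a j * m"
      "(1 + m) / 2 * (a j * m * (1 - m) / (1 - m\<^sup>2)) + (1 - m) / 2 * (a j * m * (-1 - m) / (1 - m\<^sup>2)) = 0"
      by (simp_all add: divide_simps) (simp_all add: algebra_simps power2_eq_square)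
    then have j_factor: "(1 + exp (- a j * t)) / 2 * h j 1 + (1 - exp (- a j * t)) / 2 * h j (-1)
        = (if j \<in> A then a j * exp (- a j * t) else 0)"
      unfolding h_def score_def m_def by (cases "j \<in> A") simp_all
    show "(1 + exp (- a k * t)) / 2 * h k 1 + (1 - exp (- a k * t)) / 2 * h k (-1)
      = (if k = j then if j \<in> A then a j else 0 else 1) * (if k \<in> A then exp (- a k * t) else 1)"
    proof (cases "k = j")
      case True
      then show ?thesis using j_factor by simp
    next
      case False
      then show ?thesis by (simp add: h_def field_simps)
    qed
  qed
  also have "\<dots> = (if j \<in> A then a j else 0) * (\<Prod>k\<in>A. exp (- a k * t))"
    unfolding prod.distrib using j A by (simp add: prod.If_cases Int_absorb1)
  also have "(\<Prod>k\<in>A. exp (- a k * t)) = exp (- t * (\<Sum>k\<in>A. a k))"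
    using fA by (simp add: exp_sum [symmetric] sum_distrib_left sum_negf mult.commute)
  finally show ?thesis by simp
qed

text \<open>The function \<open>\<Sum>\<^sub>j \<delta>\<^sub>j a\<^sub>j D\<^sub>j exp (- t \<Delta>) g\<close>, on the Walsh side. This form is smooth in \<open>t\<close> up to and including
  \<open>t = 0\<close>, where the score is singular.\<close>
definition heat_gradient :: "nat \<Rightarrow> (nat \<Rightarrow> real) \<Rightarrow> ((nat \<Rightarrow> real) \<Rightarrow> 'x::real_vector) \<Rightarrow> real
    \<Rightarrow> (nat \<Rightarrow> real) \<Rightarrow> (nat \<Rightarrow> real) \<Rightarrow> 'x" where
  "heat_gradient n a g t \<delta> \<epsilon> = (\<Sum>A\<in>Pow {1..n}.
     ((\<Sum>j\<in>A. \<delta> j * a j) * exp (- t * (\<Sum>j\<in>A. a j)) * walsh A \<epsilon>) *\<^sub>R walsh_coeff n g A)"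

text \<open>Both sides are linear in \<open>g\<close> and agree on Walsh functions, because \<open>W\<^sub>A(\<epsilon>\<xi>) = W\<^sub>A(\<epsilon>) W\<^sub>A(\<xi>)\<close>.\<close>
lemma heat_gradient_eq_average:
  assumes a: "\<And>j. j \<in> {1..n} \<Longrightarrow> a j > 0" and t: "t > 0" and \<epsilon>: "\<epsilon> \<in> Omega n"
  shows "heat_gradient n a g t \<delta> \<epsilon> = (\<Sum>\<xi>\<in>Omega n.
    (sign_weight n (\<lambda>j. exp (- a j * t)) \<xi> * score_sum n a t \<delta> \<xi>) *\<^sub>R g (cube_mult n \<epsilon> \<xi>))"
proof -
  define w where "w \<xi> = sign_weight n (\<lambda>j. exp (- a j * t)) \<xi>" for \<xi>
  have coeff: "(\<Sum>\<xi>\<in>Omega n. w \<xi> * score_sum n a t \<delta> \<xi> * walsh A \<xi>)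
      = (\<Sum>j\<in>A. \<delta> j * a j) * exp (- t * (\<Sum>j\<in>A. a j))" if A: "A \<subseteq> {1..n}" for A
  proof -
    have "(\<Sum>\<xi>\<in>Omega n. w \<xi> * score_sum n a t \<delta> \<xi> * walsh A \<xi>)
        = (\<Sum>\<xi>\<in>Omega n. \<Sum>j\<in>{1..n}. \<delta> j * (w \<xi> * (score a t j (\<xi> j) * walsh A \<xi>)))"
      unfolding score_sum_def sum_distrib_left sum_distrib_right by (simp only: ac_simps)
    also have "\<dots> = (\<Sum>j\<in>{1..n}. \<Sum>\<xi>\<in>Omega n. \<delta> j * (w \<xi> * (score a t j (\<xi> j) * walsh A \<xi>)))"
      by (rule sum.swap)
    also have "\<dots> = (\<Sum>j\<in>{1..n}. \<delta> j * (if j \<in> A then a j * exp (- t * (\<Sum>k\<in>A. a k)) else 0))"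
      unfolding sum_distrib_left [symmetric] w_def
      by (intro sum.cong refl) (simp only: score_walsh_correlation [of n a, OF a t _ A])
    also have "\<dots> = (\<Sum>j\<in>{1..n}. if j \<in> A then \<delta> j * a j * exp (- t * (\<Sum>k\<in>A. a k)) else 0)"
      by (intro sum.cong refl) simp
    also have "\<dots> = (\<Sum>j\<in>A. \<delta> j * a j * exp (- t * (\<Sum>k\<in>A. a k)))"
      using A by (simp add: sum.If_cases Int_absorb1)
    finally show ?thesis by (simp only: sum_distrib_right)
  qed
  have "(\<Sum>\<xi>\<in>Omega n. (w \<xi> * score_sum n a t \<delta> \<xi>) *\<^sub>R g (cube_mult n \<epsilon> \<xi>))
      = (\<Sum>\<xi>\<in>Omega n. \<Sum>A\<in>Pow {1..n}.
          (w \<xi> * score_sum n a t \<delta> \<xi> * walsh A \<xi> * walsh A \<epsilon>) *\<^sub>R walsh_coeff n g A)"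
  proof (intro sum.cong refl)
    fix \<xi> assume \<xi>: "\<xi> \<in> Omega n"
    have "g (cube_mult n \<epsilon> \<xi>) = (\<Sum>A\<in>Pow {1..n}. (walsh A \<xi> * walsh A \<epsilon>) *\<^sub>R walsh_coeff n g A)"
      unfolding walsh_expansion [OF cube_mult_Omega [OF \<epsilon> \<xi>], where g = g, symmetric]
      by (intro sum.cong refl) (simp add: walsh_cube_mult mult.commute)
    then show "(w \<xi> * score_sum n a t \<delta> \<xi>) *\<^sub>R g (cube_mult n \<epsilon> \<xi>)
      = (\<Sum>A\<in>Pow {1..n}. (w \<xi> * score_sum n a t \<delta> \<xi> * walsh A \<xi> * walsh A \<epsilon>) *\<^sub>R walsh_coeff n g A)"
      by (simp add: scaleR_sum_right mult.assoc)
  qed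
  also have "\<dots> = (\<Sum>A\<in>Pow {1..n}. \<Sum>\<xi>\<in>Omega n.
          (w \<xi> * score_sum n a t \<delta> \<xi> * walsh A \<xi> * walsh A \<epsilon>) *\<^sub>R walsh_coeff n g A)"
    by (rule sum.swap)
  also have "\<dots> = heat_gradient n a g t \<delta> \<epsilon>"
    unfolding heat_gradient_def
    by (intro sum.cong refl) (simp add: scaleR_sum_left [symmetric] sum_distrib_right [symmetric] coeff del: mult_minus_left)
  finally show ?thesis by (simp only: w_def)
qed

lemma Lp_norm_sum: "Lp_norm n p g = ((\<Sum>\<epsilon>\<in>Omega n. norm (g \<epsilon>) powr p) / 2 ^ n) powr (1 / p)"
proof -
  have "Omega n \<noteq> {}" using card_Omega [of n] by auto
  then show ?thesis by (simp add: Lp_norm_def integral_pmf_of_set card_Omega)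
qed

text \<open>Jensen's inequality for the average over \<open>\<xi>\<close> moves the power inside. After that the mean over
  \<open>\<epsilon>\<close> can be taken first; it turns \<open>g(\<epsilon>\<xi>)\<close> into \<open>g(\<epsilon>)\<close> for each fixed \<open>\<xi>\<close>, so that the \<open>p\<close>-th moment of the
  score sum splits off as a factor. The weight \<open>1 / 4 ^ n\<close> is the mass of a pair
  \<open>(\<epsilon>, \<delta>)\<close>.\<close>
lemma heat_gradient_Lp_le:
  fixes g :: "(nat \<Rightarrow> real) \<Rightarrow> 'x::real_normed_vector"
  assumes a: "\<And>j. j \<in> {1..n} \<Longrightarrow> a j > 0" and t: "t > 0" and p: "p \<ge> 1"
  shows "(\<Sum>(\<epsilon>, \<delta>)\<in>Omega n \<times> Omega n. 1 / 4 ^ n * norm (heat_gradient n a g t \<delta> \<epsilon>) powr p) powr (1 / p)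
    \<le> score_norm n p a t * Lp_norm n p g"
proof -
  define w where "w \<xi> = sign_weight n (\<lambda>j. exp (- a j * t)) \<xi>" for \<xi>
  define S where "S = score_sum n a t"
  define G where "G = (\<Sum>\<epsilon>\<in>Omega n. norm (g \<epsilon>) powr p)"
  define K where "K = (\<Sum>\<delta>\<in>Omega n. 1 / 2 ^ n * (\<Sum>\<xi>\<in>Omega n. w \<xi> * \<bar>S \<delta> \<xi>\<bar> powr p))"
  have w0: "w \<xi> \<ge> 0" if "\<xi> \<in> Omega n" for \<xi>
    unfolding w_def using that exp_neg_bounds(2) [OF a t] by (intro sign_weight_nonneg) (auto simp: less_imp_le)
  have w1: "(\<Sum>\<xi>\<in>Omega n. w \<xi>) = 1" unfolding w_def by (rule sum_sign_weight)
  have pointwise: "norm (heat_gradient n a g t \<delta> \<epsilon>) powr p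
      \<le> (\<Sum>\<xi>\<in>Omega n. w \<xi> * \<bar>S \<delta> \<xi>\<bar> powr p * norm (g (cube_mult n \<epsilon> \<xi>)) powr p)"
    if \<epsilon>: "\<epsilon> \<in> Omega n" for \<epsilon> \<delta>
  proof -
    have "norm (heat_gradient n a g t \<delta> \<epsilon>) \<le> (\<Sum>\<xi>\<in>Omega n. w \<xi> * (\<bar>S \<delta> \<xi>\<bar> * norm (g (cube_mult n \<epsilon> \<xi>))))"
    proof -
      have "heat_gradient n a g t \<delta> \<epsilon> = (\<Sum>\<xi>\<in>Omega n. (w \<xi> * S \<delta> \<xi>) *\<^sub>R g (cube_mult n \<epsilon> \<xi>))"
        unfolding w_def S_def by (rule heat_gradient_eq_average) (use a t \<epsilon> in auto)
      also have "norm \<dots> \<le> (\<Sum>\<xi>\<in>Omega n. norm ((w \<xi> * S \<delta> \<xi>) *\<^sub>R g (cube_mult n \<epsilon> \<xi>)))"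
        by (rule norm_sum)
      also have "\<dots> = (\<Sum>\<xi>\<in>Omega n. w \<xi> * (\<bar>S \<delta> \<xi>\<bar> * norm (g (cube_mult n \<epsilon> \<xi>))))"
        using w0 by (intro sum.cong refl) (simp add: abs_mult)
      finally show ?thesis .
    qed
    then have "norm (heat_gradient n a g t \<delta> \<epsilon>) powr p
        \<le> (\<Sum>\<xi>\<in>Omega n. w \<xi> * (\<bar>S \<delta> \<xi>\<bar> * norm (g (cube_mult n \<epsilon> \<xi>)))) powr p"
      using p by (intro powr_mono2) auto
    also have "\<dots> \<le> (\<Sum>\<xi>\<in>Omega n. w \<xi> * (\<bar>S \<delta> \<xi>\<bar> * norm (g (cube_mult n \<epsilon> \<xi>))) powr p)"
      using w0 w1 p by (intro weighted_mean_powr_le) auto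
    finally show ?thesis by (simp add: powr_mult mult.assoc)
  qed
  have "(\<Sum>(\<epsilon>, \<delta>)\<in>Omega n \<times> Omega n. 1 / 4 ^ n * norm (heat_gradient n a g t \<delta> \<epsilon>) powr p)
      \<le> (\<Sum>(\<epsilon>, \<delta>)\<in>Omega n \<times> Omega n. 1 / 4 ^ n *
          (\<Sum>\<xi>\<in>Omega n. w \<xi> * \<bar>S \<delta> \<xi>\<bar> powr p * norm (g (cube_mult n \<epsilon> \<xi>)) powr p))"
    by (intro sum_mono) (auto intro!: divide_right_mono pointwise)
  also have "\<dots> = (\<Sum>\<delta>\<in>Omega n. \<Sum>\<epsilon>\<in>Omega n. 1 / 4 ^ n *
          (\<Sum>\<xi>\<in>Omega n. w \<xi> * \<bar>S \<delta> \<xi>\<bar> powr p * norm (g (cube_mult n \<epsilon> \<xi>)) powr p))"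
    by (subst sum.cartesian_product [symmetric]) (rule sum.swap)
  also have "\<dots> = (\<Sum>\<delta>\<in>Omega n. 1 / 4 ^ n * (\<Sum>\<xi>\<in>Omega n. w \<xi> * \<bar>S \<delta> \<xi>\<bar> powr p * G))"
  proof (intro sum.cong refl)
    fix \<delta>
    have "(\<Sum>\<epsilon>\<in>Omega n. \<Sum>\<xi>\<in>Omega n. w \<xi> * \<bar>S \<delta> \<xi>\<bar> powr p * norm (g (cube_mult n \<epsilon> \<xi>)) powr p)
        = (\<Sum>\<xi>\<in>Omega n. w \<xi> * \<bar>S \<delta> \<xi>\<bar> powr p * (\<Sum>\<epsilon>\<in>Omega n. norm (g (cube_mult n \<epsilon> \<xi>)) powr p))"
      unfolding sum_distrib_left by (rule sum.swap)
    also have "\<dots> = (\<Sum>\<xi>\<in>Omega n. w \<xi> * \<bar>S \<delta> \<xi>\<bar> powr p * G)"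
      unfolding G_def by (intro sum.cong refl) (simp add: sum_cube_mult [where h = "\<lambda>\<epsilon>. norm (g \<epsilon>) powr p"])
    finally have "1 / 4 ^ n * (\<Sum>\<epsilon>\<in>Omega n. \<Sum>\<xi>\<in>Omega n. w \<xi> * \<bar>S \<delta> \<xi>\<bar> powr p * norm (g (cube_mult n \<epsilon> \<xi>)) powr p)
        = 1 / 4 ^ n * (\<Sum>\<xi>\<in>Omega n. w \<xi> * \<bar>S \<delta> \<xi>\<bar> powr p * G)"
      by (rule arg_cong)
    then show "(\<Sum>\<epsilon>\<in>Omega n. 1 / 4 ^ n * (\<Sum>\<xi>\<in>Omega n. w \<xi> * \<bar>S \<delta> \<xi>\<bar> powr p * norm (g (cube_mult n \<epsilon> \<xi>)) powr p))
        = 1 / 4 ^ n * (\<Sum>\<xi>\<in>Omega n. w \<xi> * \<bar>S \<delta> \<xi>\<bar> powr p * G)"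
      by (rule trans [OF sum_distrib_left [symmetric]])
  qed
  also have "\<dots> = K * (G / 2 ^ n)"
  proof -
    have "(4::real) ^ n = 2 ^ n * 2 ^ n" by (simp flip: power_mult_distrib)
    then show ?thesis
      unfolding K_def sum_distrib_right [where r = G, symmetric] sum_distrib_right [where r = "G / 2 ^ n"]
      by simp
  qed
  finally have "(\<Sum>(\<epsilon>, \<delta>)\<in>Omega n \<times> Omega n. 1 / 4 ^ n * norm (heat_gradient n a g t \<delta> \<epsilon>) powr p)
      \<le> K * (G / 2 ^ n)" .
  then have "(\<Sum>(\<epsilon>, \<delta>)\<in>Omega n \<times> Omega n. 1 / 4 ^ n * norm (heat_gradient n a g t \<delta> \<epsilon>) powr p) powr (1 / p)
      \<le> (K * (G / 2 ^ n)) powr (1 / p)"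
    using p by (intro powr_mono2) (auto intro!: sum_nonneg)
  also have "\<dots> = K powr (1 / p) * (G / 2 ^ n) powr (1 / p)"
    by (rule powr_mult)
  finally show ?thesis
    unfolding score_norm_def Lp_norm_sum G_def K_def w_def S_def .
qed

section \<open>Integration along the semigroup\<close>

lemma score_norm_measurable [measurable]: "score_norm n p a \<in> borel_measurable borel"
  unfolding score_norm_def [abs_def] score_sum_def score_def sign_weight_def by measurable

text \<open>An antiderivative in \<open>t\<close> of the heat gradient that vanishes at infinity. The term \<open>A = {}\<close> is
  \<open>0 / 0 = 0\<close>, which matches the convention that the inverse of \<open>\<Delta>\<close> kills constants.\<close>
definition heat_primitive :: "nat \<Rightarrow> (nat \<Rightarrow> real) \<Rightarrow> ((nat \<Rightarrow> real) \<Rightarrow> 'x::real_vector) \<Rightarrow> real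
    \<Rightarrow> (nat \<Rightarrow> real) \<Rightarrow> (nat \<Rightarrow> real) \<Rightarrow> 'x" where
  "heat_primitive n a g t \<delta> \<epsilon> = (\<Sum>A\<in>Pow {1..n}.
     (- ((\<Sum>j\<in>A. \<delta> j * a j) / (\<Sum>j\<in>A. a j)) * exp (- t * (\<Sum>j\<in>A. a j)) * walsh A \<epsilon>)
       *\<^sub>R walsh_coeff n g A)"

lemma sum_pos_of_nonempty:
  fixes a :: "nat \<Rightarrow> real"
  assumes "\<And>j. j \<in> {1..n} \<Longrightarrow> a j > 0" "A \<subseteq> {1..n}" "A \<noteq> {}"
  shows "(\<Sum>j\<in>A. a j) > 0"
  using assms finite_subset [OF assms(2) finite_atLeastAtMost] by (intro sum_pos) auto

lemma heat_primitive_deriv: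
  fixes g :: "(nat \<Rightarrow> real) \<Rightarrow> 'x::real_normed_vector"
  assumes a: "\<And>j. j \<in> {1..n} \<Longrightarrow> a j > 0"
  shows "((\<lambda>t. heat_primitive n a g t \<delta> \<epsilon>) has_vector_derivative heat_gradient n a g t \<delta> \<epsilon>) (at t within S)"
  unfolding heat_primitive_def heat_gradient_def
proof (intro has_vector_derivative_sum)
  fix A assume "A \<in> Pow {1..n}"
  then have A: "A \<subseteq> {1..n}" by simp
  define s where "s = (\<Sum>j\<in>A. a j)"
  define d where "d = (\<Sum>j\<in>A. \<delta> j * a j)"
  have "d / s * s = d"
    using sum_pos_of_nonempty [of n a, OF a A] by (cases "A = {}") (auto simp: s_def d_def)
  then have "- (d / s) * (- s * exp (- t * s)) * walsh A \<epsilon> = d * exp (- t * s) * walsh A \<epsilon>"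
    by (simp only: mult.assoc [symmetric] minus_mult_minus)
  moreover have "((\<lambda>t. - (d / s) * exp (- t * s) * walsh A \<epsilon>) has_real_derivative
      - (d / s) * (- s * exp (- t * s)) * walsh A \<epsilon>) (at t within S)"
    by (auto intro!: derivative_eq_intros)
  ultimately have "((\<lambda>t. - (d / s) * exp (- t * s) * walsh A \<epsilon>) has_real_derivative
      d * exp (- t * s) * walsh A \<epsilon>) (at t within S)" by (simp only:)
  from has_vector_derivative_scaleR [OF this has_vector_derivative_const [of "walsh_coeff n g A"]]
  show "((\<lambda>t. (- ((\<Sum>j\<in>A. \<delta> j * a j) / (\<Sum>j\<in>A. a j)) * exp (- t * (\<Sum>j\<in>A. a j)) * walsh A \<epsilon>)
         *\<^sub>R walsh_coeff n g A) has_vector_derivative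
      ((\<Sum>j\<in>A. \<delta> j * a j) * exp (- t * (\<Sum>j\<in>A. a j)) * walsh A \<epsilon>) *\<^sub>R walsh_coeff n g A) (at t within S)"
    by (simp add: s_def d_def)
qed

lemma heat_primitive_0:
  "heat_primitive n a g 0 \<delta> \<epsilon> = - (\<Sum>j\<in>{1..n}. \<delta> j *\<^sub>R a j *\<^sub>R Delta_inv n a (D_op n j g) \<epsilon>)"
proof -
  have "(\<Sum>j\<in>{1..n}. \<delta> j *\<^sub>R a j *\<^sub>R Delta_inv n a (D_op n j g) \<epsilon>)
      = (\<Sum>j\<in>{1..n}. \<Sum>A\<in>Pow {1..n}.
          ((if j \<in> A then \<delta> j * a j else 0) / (\<Sum>k\<in>A. a k) * walsh A \<epsilon>) *\<^sub>R walsh_coeff n g A)"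
    unfolding Delta_inv_D_op scaleR_sum_right by (intro sum.cong refl) auto
  also have "\<dots> = (\<Sum>A\<in>Pow {1..n}. \<Sum>j\<in>{1..n}.
          ((if j \<in> A then \<delta> j * a j else 0) / (\<Sum>k\<in>A. a k) * walsh A \<epsilon>) *\<^sub>R walsh_coeff n g A)"
    by (rule sum.swap)
  also have "\<dots> = (\<Sum>A\<in>Pow {1..n}.
          ((\<Sum>j\<in>A. \<delta> j * a j) / (\<Sum>k\<in>A. a k) * walsh A \<epsilon>) *\<^sub>R walsh_coeff n g A)"
  proof (intro sum.cong refl)
    fix A assume "A \<in> Pow {1..n}"
    then have "(\<Sum>j\<in>A. \<delta> j * a j) = (\<Sum>j\<in>{1..n}. if j \<in> A then \<delta> j * a j else 0)"
      by (simp add: sum.If_cases Int_absorb1)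
    then show "(\<Sum>j\<in>{1..n}. ((if j \<in> A then \<delta> j * a j else 0) / (\<Sum>k\<in>A. a k) * walsh A \<epsilon>) *\<^sub>R walsh_coeff n g A)
      = ((\<Sum>j\<in>A. \<delta> j * a j) / (\<Sum>k\<in>A. a k) * walsh A \<epsilon>) *\<^sub>R walsh_coeff n g A"
      by (simp only: scaleR_sum_left sum_distrib_right sum_divide_distrib)
  qed
  finally show ?thesis by (simp add: heat_primitive_def sum_negf)
qed

lemma heat_primitive_tendsto_0:
  fixes g :: "(nat \<Rightarrow> real) \<Rightarrow> 'x::real_normed_vector"
  assumes a: "\<And>j. j \<in> {1..n} \<Longrightarrow> a j > 0"
  shows "((\<lambda>t. heat_primitive n a g t \<delta> \<epsilon>) \<longlongrightarrow> 0) at_top"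
  unfolding heat_primitive_def
proof (intro tendsto_null_sum)
  fix A assume "A \<in> Pow {1..n}"
  then have A: "A \<subseteq> {1..n}" by simp
  show "((\<lambda>t. (- ((\<Sum>j\<in>A. \<delta> j * a j) / (\<Sum>j\<in>A. a j)) * exp (- t * (\<Sum>j\<in>A. a j)) * walsh A \<epsilon>)
         *\<^sub>R walsh_coeff n g A) \<longlongrightarrow> 0) at_top"
  proof (cases "A = {}")
    case False
    define s where "s = (\<Sum>j\<in>A. a j)"
    have "s > 0" using sum_pos_of_nonempty [of n a, OF a A False] by (simp add: s_def)
    then have "LIM t at_top. s * t :> at_top"
      by (rule filterlim_tendsto_pos_mult_at_top [OF tendsto_const _ filterlim_ident])
    then have "((\<lambda>t. exp (- t * s)) \<longlongrightarrow> 0) at_top"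
      by (intro filterlim_compose [OF exp_at_bot]) (simp add: filterlim_uminus_at_bot mult.commute)
    then have "((\<lambda>t. (- ((\<Sum>j\<in>A. \<delta> j * a j) / s) * exp (- t * s) * walsh A \<epsilon>) *\<^sub>R walsh_coeff n g A) \<longlongrightarrow>
        (- ((\<Sum>j\<in>A. \<delta> j * a j) / s) * 0 * walsh A \<epsilon>) *\<^sub>R walsh_coeff n g A) at_top"
      by (intro tendsto_intros)
    then show ?thesis by (simp add: s_def)
  qed simp
qed

lemma continuous_heat_gradient:
  fixes g :: "(nat \<Rightarrow> real) \<Rightarrow> 'x::real_normed_vector"
  shows "continuous_on S (\<lambda>t. heat_gradient n a g t \<delta> \<epsilon>)"
  unfolding heat_gradient_def by (intro continuous_intros)

text \<open>The estimate by the score holds for \<open>t > 0\<close> only; the point \<open>t = 0\<close> is negligible in the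
  integral.\<close>
lemma heat_primitive_Lp_le_Lambda:
  fixes g :: "(nat \<Rightarrow> real) \<Rightarrow> 'x::banach"
  assumes a: "\<And>j. j \<in> {1..n} \<Longrightarrow> a j > 0" and p: "p \<ge> 1" and T: "T \<ge> 0"
  shows "ennreal ((\<Sum>(\<epsilon>, \<delta>)\<in>Omega n \<times> Omega n. 1 / 4 ^ n *
      norm (heat_primitive n a g T \<delta> \<epsilon> - heat_primitive n a g 0 \<delta> \<epsilon>) powr p) powr (1 / p))
    \<le> Lambda n p a * ennreal (Lp_norm n p g)"
proof -
  define N where "N t = (\<Sum>(\<epsilon>, \<delta>)\<in>Omega n \<times> Omega n.
    1 / 4 ^ n * norm (heat_gradient n a g t \<delta> \<epsilon>) powr p) powr (1 / p)" for t
  have "p > 0" using p by simp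
  then have "continuous_on {0..T} (\<lambda>t. norm (heat_gradient n a g t \<delta> \<epsilon>) powr p)" for \<epsilon> \<delta>
    by (intro continuous_on_powr' continuous_on_norm continuous_heat_gradient continuous_on_const) auto
  then have cont_sum: "continuous_on {0..T} (\<lambda>t. \<Sum>(\<epsilon>, \<delta>)\<in>Omega n \<times> Omega n.
      1 / 4 ^ n * norm (heat_gradient n a g t \<delta> \<epsilon>) powr p)"
    unfolding split_beta by (intro continuous_on_sum continuous_on_mult continuous_on_const)
  have contN: "continuous_on {0..T} N"
    unfolding N_def using \<open>p > 0\<close>
    by (intro continuous_on_powr' [OF cont_sum continuous_on_const]) (auto intro!: sum_nonneg)
  have "(\<Sum>(\<epsilon>, \<delta>)\<in>Omega n \<times> Omega n. 1 / 4 ^ n *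
      norm (heat_primitive n a g T \<delta> \<epsilon> - heat_primitive n a g 0 \<delta> \<epsilon>) powr p) powr (1 / p)
    \<le> integral {0..T} N"
    unfolding N_def split_beta
    by (rule Minkowski_integral)
       (use p T in \<open>auto intro!: heat_primitive_deriv a continuous_heat_gradient\<close>)
  then have "ennreal ((\<Sum>(\<epsilon>, \<delta>)\<in>Omega n \<times> Omega n. 1 / 4 ^ n *
      norm (heat_primitive n a g T \<delta> \<epsilon> - heat_primitive n a g 0 \<delta> \<epsilon>) powr p) powr (1 / p))
    \<le> ennreal (integral {0..T} N)" by (rule ennreal_leI)
  also have "\<dots> = (\<integral>\<^sup>+t. ennreal (N t) * indicator {0..T} t \<partial>lborel)"
    by (rule nn_integral_has_integral_lebesgue' [OF _ integrable_integral
        [OF integrable_continuous_real [OF contN]], symmetric]) (simp add: N_def)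
  also have "\<dots> \<le> (\<integral>\<^sup>+t. (ennreal (score_norm n p a t) * indicator {0<..} t) * ennreal (Lp_norm n p g) \<partial>lborel)"
  proof (rule nn_integral_mono_AE, use AE_lborel_singleton [of "0::real"] in eventually_elim)
    fix t :: real assume "t \<noteq> 0"
    show "ennreal (N t) * indicator {0..T} t
        \<le> (ennreal (score_norm n p a t) * indicator {0<..} t) * ennreal (Lp_norm n p g)"
    proof (cases "t \<in> {0..T}")
      case True
      with \<open>t \<noteq> 0\<close> have t: "t > 0" by simp
      have "N t \<le> score_norm n p a t * Lp_norm n p g"
        unfolding N_def by (rule heat_gradient_Lp_le) (use a t p in auto)
      then have "ennreal (N t) \<le> ennreal (score_norm n p a t) * ennreal (Lp_norm n p g)"
        by (subst ennreal_mult [symmetric]) (auto simp: score_norm_def Lp_norm_def intro!: ennreal_leI)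
      then show ?thesis using t True by simp
    qed simp
  qed
  also have "\<dots> = Lambda n p a * ennreal (Lp_norm n p g)"
  proof -
    have "Lambda n p a = (\<integral>\<^sup>+t. ennreal (score_norm n p a t) * indicator {0<..} t \<partial>lborel)"
      by (rule Lambda_eq_score_norm) (rule a)
    then show ?thesis by (simp only:) (rule nn_integral_multc, measurable)
  qed
  finally show ?thesis .
qed

text \<open>Let \<open>T\<close> tend to infinity: the increment of the primitive over \<open>[0, T]\<close> tends to
  \<open>\<Sum>\<^sub>j \<delta>\<^sub>j a\<^sub>j \<Delta>\<^sup>-\<^sup>1 D\<^sub>j g\<close>.\<close>
lemma Riesz_transform_bound:
  fixes g :: "(nat \<Rightarrow> real) \<Rightarrow> 'x::banach"
  assumes a: "\<And>j. j \<in> {1..n} \<Longrightarrow> a j > 0" and p: "p \<ge> 1"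
  shows "ennreal ((measure_pmf.expectation (pair_pmf (pmf_of_set (Omega n)) (rademacher_pmf n))
          (\<lambda>(\<epsilon>, \<delta>). norm (\<Sum>j\<in>{1..n}. \<delta> j *\<^sub>R a j *\<^sub>R Delta_inv n a (D_op n j g) \<epsilon>) powr p))
        powr (1 / p))
      \<le> Lambda n p a * ennreal (Lp_norm n p g)"
proof -
  define R where "R \<epsilon> \<delta> = (\<Sum>j\<in>{1..n}. \<delta> j *\<^sub>R a j *\<^sub>R Delta_inv n a (D_op n j g) \<epsilon>)" for \<epsilon> \<delta>
  define E where "E T = (\<Sum>(\<epsilon>, \<delta>)\<in>Omega n \<times> Omega n. 1 / 4 ^ n *
      norm (heat_primitive n a g T \<delta> \<epsilon> - heat_primitive n a g 0 \<delta> \<epsilon>) powr p) powr (1 / p)" for T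
  have ne: "Omega n \<noteq> {}" using card_Omega [of n] by auto
  have four: "(4::real) ^ n = 2 ^ n * 2 ^ n" by (simp flip: power_mult_distrib)
  have "measure_pmf.expectation (pair_pmf (pmf_of_set (Omega n)) (rademacher_pmf n)) (\<lambda>(\<epsilon>, \<delta>). norm (R \<epsilon> \<delta>) powr p)
      = (\<Sum>\<epsilon>\<in>Omega n. pmf (pmf_of_set (Omega n)) \<epsilon> * (\<Sum>\<delta>\<in>Omega n. pmf (rademacher_pmf n) \<delta> * norm (R \<epsilon> \<delta>) powr p))"
    unfolding rademacher_pmf_def
    by (subst expectation_pair_sum [where A = "Omega n", OF _ _ _ set_Pi_sign])
       (simp_all add: set_pmf_of_set [OF ne finite_Omega])
  also have "\<dots> = (\<Sum>\<epsilon>\<in>Omega n. \<Sum>\<delta>\<in>Omega n. 1 / 4 ^ n * norm (R \<epsilon> \<delta>) powr p)"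
    by (intro sum.cong refl)
       (simp add: rademacher_pmf_def pmf_Pi_sign [of n "\<lambda>_. 0"] sign_weight_0 ne card_Omega sum_divide_distrib four
         del: One_nat_def)
  also have "\<dots> = (\<Sum>(\<epsilon>, \<delta>)\<in>Omega n \<times> Omega n. 1 / 4 ^ n * norm (R \<epsilon> \<delta>) powr p)"
    by (rule sum.cartesian_product)
  finally have expect: "measure_pmf.expectation (pair_pmf (pmf_of_set (Omega n)) (rademacher_pmf n))
      (\<lambda>(\<epsilon>, \<delta>). norm (R \<epsilon> \<delta>) powr p)
      = (\<Sum>(\<epsilon>, \<delta>)\<in>Omega n \<times> Omega n. 1 / 4 ^ n * norm (R \<epsilon> \<delta>) powr p)" .
  have "((\<lambda>T. E T) \<longlongrightarrow> (\<Sum>(\<epsilon>, \<delta>)\<in>Omega n \<times> Omega n. 1 / 4 ^ n *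
      norm (0 - heat_primitive n a g 0 \<delta> \<epsilon>) powr p) powr (1 / p)) at_top"
    unfolding E_def split_beta using p
    by (intro tendsto_powr' tendsto_intros heat_primitive_tendsto_0 a)
       (auto intro!: sum_nonneg always_eventually)
  then have "((\<lambda>T. ennreal (E T)) \<longlongrightarrow>
      ennreal ((\<Sum>(\<epsilon>, \<delta>)\<in>Omega n \<times> Omega n. 1 / 4 ^ n * norm (R \<epsilon> \<delta>) powr p) powr (1 / p))) at_top"
    by (intro tendsto_ennrealI) (simp add: heat_primitive_0 R_def)
  moreover have "eventually (\<lambda>T. ennreal (E T) \<le> Lambda n p a * ennreal (Lp_norm n p g)) at_top"
    using eventually_ge_at_top [of 0]
  proof eventually_elim
    case (elim T)
    show ?case unfolding E_def by (rule heat_primitive_Lp_le_Lambda) (use a p elim in auto)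
  qed
  ultimately have "ennreal ((\<Sum>(\<epsilon>, \<delta>)\<in>Omega n \<times> Omega n. 1 / 4 ^ n * norm (R \<epsilon> \<delta>) powr p) powr (1 / p))
      \<le> Lambda n p a * ennreal (Lp_norm n p g)"
    by (rule tendsto_upperbound) simp
  then show ?thesis unfolding R_def [symmetric] expect .
qed

section \<open>Finiteness and monotonicity of the constant\<close>

lemma nn_integral_FTC_greaterThan_0:
  fixes f F :: "real \<Rightarrow> real"
  assumes deriv: "\<And>x. x > 0 \<Longrightarrow> (F has_real_derivative f x) (at x)"
    and cont: "\<And>x. x > 0 \<Longrightarrow> isCont f x" and nonneg: "\<And>x. x > 0 \<Longrightarrow> f x \<ge> 0"
    and lim: "(F \<longlongrightarrow> A) (at_right 0)" "(F \<longlongrightarrow> B) at_top"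
  shows "(\<integral>\<^sup>+x\<in>{0<..}. ennreal (f x) \<partial>lborel) = ennreal (B - A)"
proof -
  have A: "((F \<circ> real_of_ereal) \<longlongrightarrow> A) (at_right (0::ereal))"
    using lim(1) by (simp add: zero_ereal_def ereal_tendsto_simps)
  have B: "((F \<circ> real_of_ereal) \<longlongrightarrow> B) (at_left \<infinity>)"
    using lim(2) by (simp add: ereal_tendsto_simps)
  have e: "einterval 0 \<infinity> = {0<..}" by (auto simp: einterval_def)
  note FTC = interval_integral_FTC_nonneg [of "0::ereal" \<infinity> F f A B, OF _ _ _ _ A B]
  have int: "set_integrable lborel {0<..} f"
    unfolding e [symmetric] by (rule FTC(1)) (use deriv cont nonneg in auto)
  have "(LBINT x=0..\<infinity>. f x) = B - A"
    by (rule FTC(2)) (use deriv cont nonneg in auto)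
  then have "(LINT x:{0<..}|lborel. f x) = B - A"
    by (simp add: interval_lebesgue_integral_def e)
  then have LINT: "(\<integral>x. indicator {0<..} x *\<^sub>R f x \<partial>lborel) = B - A"
    by (simp add: set_lebesgue_integral_def)
  have "(\<integral>\<^sup>+x\<in>{0<..}. ennreal (f x) \<partial>lborel)
      = (\<integral>\<^sup>+x. ennreal (indicator {0<..} x *\<^sub>R f x) \<partial>lborel)"
    by (intro nn_integral_cong) (auto simp: indicator_def)
  also have "\<dots> = ennreal (\<integral>x. indicator {0<..} x *\<^sub>R f x \<partial>lborel)"
    by (rule nn_integral_eq_integral)
       (use int nonneg in \<open>auto simp: indicator_def set_integrable_def\<close>)
  finally show ?thesis by (simp only: LINT)
qed

lemma sum_powr_le_sum_of_powr:
  fixes x :: "'i \<Rightarrow> real"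
  assumes I: "finite I" "I \<noteq> {}" and p: "p \<ge> 1" and x: "\<And>i. i \<in> I \<Longrightarrow> x i \<ge> 0"
  shows "(\<Sum>i\<in>I. x i) powr p \<le> real (card I) powr p * (\<Sum>i\<in>I. x i powr p)"
proof -
  define N where "N = real (card I)"
  have N: "N \<ge> 1" using I by (simp add: N_def Suc_le_eq card_gt_0_iff)
  have "(\<Sum>i\<in>I. x i) powr p = N powr p * (\<Sum>i\<in>I. 1 / N * x i) powr p"
    using N by (simp add: powr_mult [symmetric] sum_divide_distrib [symmetric])
  also have "\<dots> \<le> N powr p * (\<Sum>i\<in>I. 1 / N * x i powr p)"
    using I N p x by (intro mult_left_mono weighted_mean_powr_le) (auto simp: N_def)
  also have "\<dots> \<le> N powr p * (\<Sum>i\<in>I. x i powr p)"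
    using N by (intro mult_left_mono sum_mono) (auto simp: divide_le_eq mult_le_cancel_left1)
  finally show ?thesis by (simp add: N_def)
qed

text \<open>With \<open>m = exp (- a j * t)\<close>, the score takes the values \<open>a m / (1 + m)\<close> and \<open>- a m / (1 - m)\<close> with
  probabilities \<open>(1 + m) / 2\<close> and \<open>(1 - m) / 2\<close>. Only the second value is unbounded as \<open>t\<close> tends to \<open>0\<close>, and it
  is the rare one: its contribution to the \<open>p\<close>-th moment is of order \<open>(1 - m) powr (1 - p)\<close>, so that the
  \<open>L\<^sup>p\<close> norm has a singularity of order \<open>1 - 1/p < 1\<close>, which is integrable.\<close>
lemma score_moment_le:
  assumes a: "a j > 0" and t: "t > 0" and j: "j \<in> {1..n}" and p: "p \<ge> 1"
  shows "(\<Sum>\<xi>\<in>Omega n. sign_weight n (\<lambda>j. exp (- a j * t)) \<xi> * \<bar>score a t j (\<xi> j)\<bar> powr p)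
    \<le> (a j * exp (- a j * t) * (1 - exp (- a j * t)) powr (1 / p - 1)) powr p"
proof -
  define m where "m = exp (- a j * t)"
  have m: "0 < m" "m < 1" "1 - m\<^sup>2 > 0" using exp_neg_bounds [OF a t] by (auto simp: m_def)
  have "1 - m\<^sup>2 = (1 + m) * (1 - m)" by (simp add: algebra_simps power2_eq_square)
  then have s: "score a t j 1 = a j * m / (1 + m)" "score a t j (-1) = - (a j * m / (1 - m))"
    unfolding score_def m_def [symmetric] using m
    by (simp_all add: divide_simps) (simp add: algebra_simps)
  have "(1 + m) * (1 + m) powr (- p) = (1 + m) powr (1 - p)"
    "(1 - m) * (1 - m) powr (- p) = (1 - m) powr (1 - p)"
    using m by (simp_all add: powr_diff powr_minus divide_inverse)
  moreover have "(a j * m / (1 + m)) powr p = (a j * m) powr p * (1 + m) powr (- p)"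
    "(a j * m / (1 - m)) powr p = (a j * m) powr p * (1 - m) powr (- p)"
    using m a by (simp_all add: powr_divide powr_minus_divide)
  ultimately have "(1 + m) * (a j * m / (1 + m)) powr p = (a j * m) powr p * (1 + m) powr (1 - p)"
    "(1 - m) * (a j * m / (1 - m)) powr p = (a j * m) powr p * (1 - m) powr (1 - p)"
    by (simp_all only: mult.left_commute [of _ "(a j * m) powr p"])
  then have "(1 + m) / 2 * \<bar>score a t j 1\<bar> powr p + (1 - m) / 2 * \<bar>score a t j (-1)\<bar> powr p
      = (a j * m) powr p * (((1 + m) powr (1 - p) + (1 - m) powr (1 - p)) / 2)"
    unfolding s using m a by (simp add: algebra_simps add_divide_distrib diff_divide_distrib)
  also have "\<dots> \<le> (a j * m) powr p * (1 - m) powr (1 - p)"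
  proof (rule mult_left_mono)
    have "(1 + m) powr (1 - p) \<le> 1" "1 \<le> (1 - m) powr (1 - p)"
      using m p powr_mono [of "1 - p" 0 "1 + m"] powr_mono' [of "1 - p" 0 "1 - m"] by auto
    then show "((1 + m) powr (1 - p) + (1 - m) powr (1 - p)) / 2 \<le> (1 - m) powr (1 - p)" by simp
  qed simp
  also have "\<dots> = (a j * m * (1 - m) powr (1 / p - 1)) powr p"
  proof -
    have "(1 / p - 1) * p = 1 - p" using p by (simp add: field_simps)
    then show ?thesis using a m by (simp add: powr_mult powr_powr)
  qed
  finally show ?thesis
    using sum_sign_weight_coordinate [OF j, of "\<lambda>j. exp (- a j * t)" "\<lambda>x. \<bar>score a t j x\<bar> powr p"]
    by (simp add: m_def)
qed

lemma sign_weight_heat_nonneg: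
  assumes a: "\<And>j. j \<in> {1..n} \<Longrightarrow> a j > 0" and t: "t > 0" and "\<xi> \<in> Omega n"
  shows "sign_weight n (\<lambda>j. exp (- a j * t)) \<xi> \<ge> 0"
  using assms exp_neg_bounds(2) [OF a t] by (intro sign_weight_nonneg) (auto simp: less_imp_le)

text \<open>A crude bound: the constant in front of the sum only has to be finite.\<close>
lemma score_norm_le:
  assumes n: "n \<ge> 1" and a: "\<And>j. j \<in> {1..n} \<Longrightarrow> a j > 0" and t: "t > 0" and p: "p \<ge> 1"
  shows "score_norm n p a t
    \<le> real n * real n powr (1 / p) * (\<Sum>j\<in>{1..n}. a j * exp (- a j * t) * (1 - exp (- a j * t)) powr (1 / p - 1))"
proof -
  define y where "y j = a j * exp (- a j * t) * (1 - exp (- a j * t)) powr (1 / p - 1)" for j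
  define Y where "Y = (\<Sum>j\<in>{1..n}. y j)"
  define w where "w \<xi> = sign_weight n (\<lambda>j. exp (- a j * t)) \<xi>" for \<xi>
  have w0: "w \<xi> \<ge> 0" if "\<xi> \<in> Omega n" for \<xi>
    unfolding w_def by (rule sign_weight_heat_nonneg) (use a t that in auto)
  have y0: "y j \<ge> 0" if "j \<in> {1..n}" for j using a [OF that] by (simp add: y_def)
  have Y0: "Y \<ge> 0" unfolding Y_def using y0 by (rule sum_nonneg)
  have inner: "(\<Sum>\<xi>\<in>Omega n. w \<xi> * \<bar>score_sum n a t \<delta> \<xi>\<bar> powr p) \<le> real n powr p * (real n * Y powr p)"
    if \<delta>: "\<delta> \<in> Omega n" for \<delta>
  proof -
    have "\<bar>score_sum n a t \<delta> \<xi>\<bar> \<le> (\<Sum>j\<in>{1..n}. \<bar>score a t j (\<xi> j)\<bar>)" for \<xi>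
    proof -
      have "\<bar>score_sum n a t \<delta> \<xi>\<bar> \<le> (\<Sum>j\<in>{1..n}. \<bar>\<delta> j * score a t j (\<xi> j)\<bar>)"
        unfolding score_sum_def by (rule sum_abs)
      also have "\<dots> = (\<Sum>j\<in>{1..n}. \<bar>score a t j (\<xi> j)\<bar>)"
        using Omega_values [OF \<delta>] by (intro sum.cong refl) (fastforce simp: abs_mult)
      finally show ?thesis .
    qed
    then have "\<bar>score_sum n a t \<delta> \<xi>\<bar> powr p \<le> (\<Sum>j\<in>{1..n}. \<bar>score a t j (\<xi> j)\<bar>) powr p" for \<xi>
      using p by (intro powr_mono2) auto
    also have "(\<Sum>j\<in>{1..n}. \<bar>score a t j (\<xi> j)\<bar>) powr p
        \<le> real n powr p * (\<Sum>j\<in>{1..n}. \<bar>score a t j (\<xi> j)\<bar> powr p)" for \<xi>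
      using p n sum_powr_le_sum_of_powr [of "{1..n}" p "\<lambda>j. \<bar>score a t j (\<xi> j)\<bar>"] by simp
    finally have "\<bar>score_sum n a t \<delta> \<xi>\<bar> powr p
        \<le> real n powr p * (\<Sum>j\<in>{1..n}. \<bar>score a t j (\<xi> j)\<bar> powr p)" for \<xi> .
    then have "(\<Sum>\<xi>\<in>Omega n. w \<xi> * \<bar>score_sum n a t \<delta> \<xi>\<bar> powr p)
        \<le> (\<Sum>\<xi>\<in>Omega n. w \<xi> * (real n powr p * (\<Sum>j\<in>{1..n}. \<bar>score a t j (\<xi> j)\<bar> powr p)))"
      using w0 by (intro sum_mono mult_left_mono) auto
    also have "\<dots> = (\<Sum>\<xi>\<in>Omega n. \<Sum>j\<in>{1..n}. real n powr p * (w \<xi> * \<bar>score a t j (\<xi> j)\<bar> powr p))"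
      unfolding sum_distrib_left by (intro sum.cong refl) simp
    also have "\<dots> = (\<Sum>j\<in>{1..n}. real n powr p * (\<Sum>\<xi>\<in>Omega n. w \<xi> * \<bar>score a t j (\<xi> j)\<bar> powr p))"
      unfolding sum_distrib_left by (rule sum.swap)
    also have "\<dots> \<le> (\<Sum>j\<in>{1..n}. real n powr p * Y powr p)"
    proof (intro sum_mono mult_left_mono)
      fix j assume j: "j \<in> {1..n}"
      have "(\<Sum>\<xi>\<in>Omega n. w \<xi> * \<bar>score a t j (\<xi> j)\<bar> powr p) \<le> y j powr p"
        unfolding w_def y_def by (rule score_moment_le [where a = a and j = j, OF a [OF j] t j p])
      also have "y j \<le> Y"
        unfolding Y_def using j y0 by (intro member_le_sum) auto
      then have "y j powr p \<le> Y powr p" using y0 [OF j] p by (intro powr_mono2) auto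
      finally show "(\<Sum>\<xi>\<in>Omega n. w \<xi> * \<bar>score a t j (\<xi> j)\<bar> powr p) \<le> Y powr p" .
    qed simp
    also have "\<dots> = real n powr p * (real n * Y powr p)" by simp
    finally show ?thesis .
  qed
  have "score_norm n p a t \<le> (\<Sum>\<delta>\<in>Omega n. 1 / 2 ^ n * (real n powr p * (real n * Y powr p))) powr (1 / p)"
    unfolding score_norm_def w_def [symmetric]
    using p w0 inner by (intro powr_mono2 sum_mono mult_left_mono sum_nonneg mult_nonneg_nonneg) auto
  also have "\<dots> = (real n powr p * (real n * Y powr p)) powr (1 / p)"
    by (simp add: card_Omega)
  also have "\<dots> = real n * (real n powr (1 / p) * Y)"
    using p Y0 by (simp add: powr_mult powr_powr)
  finally show ?thesis by (simp add: Y_def y_def mult.assoc)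
qed

lemma nn_integral_score_bound:
  fixes c p :: real
  assumes c: "c > 0" and p: "p \<ge> 1"
  shows "(\<integral>\<^sup>+t\<in>{0<..}. ennreal (c * exp (- c * t) * (1 - exp (- c * t)) powr (1 / p - 1)) \<partial>lborel) = ennreal p"
proof -
  have pos: "1 - exp (- c * t) > 0" if "t > 0" for t using c that by simp
  have "(\<integral>\<^sup>+t\<in>{0<..}. ennreal (c * exp (- c * t) * (1 - exp (- c * t)) powr (1 / p - 1)) \<partial>lborel)
      = ennreal (p * 1 powr (1 / p) - p * 0 powr (1 / p))"
  proof (rule nn_integral_FTC_greaterThan_0 [where F = "\<lambda>t. p * (1 - exp (- c * t)) powr (1 / p)"])
    fix t :: real assume t: "t > 0"
    show "((\<lambda>t. p * (1 - exp (- c * t)) powr (1 / p)) has_real_derivative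
        c * exp (- c * t) * (1 - exp (- c * t)) powr (1 / p - 1)) (at t)"
      using pos [OF t] p by (auto intro!: derivative_eq_intros simp: powr_diff field_simps)
    show "isCont (\<lambda>t. c * exp (- c * t) * (1 - exp (- c * t)) powr (1 / p - 1)) t"
      using pos [OF t] by (intro continuous_intros) auto
    show "0 \<le> c * exp (- c * t) * (1 - exp (- c * t)) powr (1 / p - 1)" using c by simp
  next
    have "((\<lambda>t. 1 - exp (- c * t)) \<longlongrightarrow> 1 - exp (- c * 0)) (at_right 0)" by (intro tendsto_intros)
    then have "((\<lambda>t. 1 - exp (- c * t)) \<longlongrightarrow> 0) (at_right 0)" by simp
    then show "((\<lambda>t. p * (1 - exp (- c * t)) powr (1 / p)) \<longlongrightarrow> p * 0 powr (1 / p)) (at_right 0)"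
      using p pos by (intro tendsto_mult tendsto_const tendsto_powr')
        (auto simp: eventually_at_right_less intro!: eventually_at_rightI [of 0 1] less_imp_le)
  next
    have "LIM t at_top. c * t :> at_top"
      by (rule filterlim_tendsto_pos_mult_at_top [OF tendsto_const c filterlim_ident])
    then have "((\<lambda>t. exp (- c * t)) \<longlongrightarrow> 0) at_top"
      by (intro filterlim_compose [OF exp_at_bot]) (simp add: filterlim_uminus_at_bot)
    then have "((\<lambda>t. 1 - exp (- c * t)) \<longlongrightarrow> 1 - 0) at_top" by (intro tendsto_intros)
    then show "((\<lambda>t. p * (1 - exp (- c * t)) powr (1 / p)) \<longlongrightarrow> p * 1 powr (1 / p)) at_top"
      by (intro tendsto_mult tendsto_const tendsto_powr) auto
  qed
  then show ?thesis by simp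
qed

lemma Lambda_finite:
  assumes n: "n \<ge> 1" and a: "\<And>j. j \<in> {1..n} \<Longrightarrow> a j > 0" and p: "p \<ge> 1"
  shows "Lambda n p a < \<infinity>"
proof -
  have L: "Lambda n r a = (\<integral>\<^sup>+t\<in>{0<..}. ennreal (score_norm n r a t) \<partial>lborel)" for r
    by (rule Lambda_eq_score_norm) (rule a)
  define C where "C = real n * real n powr (1 / p)"
  define y where "y j t = a j * exp (- a j * t) * (1 - exp (- a j * t)) powr (1 / p - 1)" for j t
  have y0: "y j t \<ge> 0" if "j \<in> {1..n}" for j t using a [OF that] by (simp add: y_def)
  have "Lambda n p a \<le> (\<integral>\<^sup>+t. (\<Sum>j\<in>{1..n}. ennreal C * (ennreal (y j t) * indicator {0<..} t)) \<partial>lborel)"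
    unfolding L
  proof (intro nn_integral_mono)
    fix t :: real
    show "ennreal (score_norm n p a t) * indicator {0<..} t
        \<le> (\<Sum>j\<in>{1..n}. ennreal C * (ennreal (y j t) * indicator {0<..} t))"
    proof (cases "t > 0")
      case True
      have "score_norm n p a t \<le> (\<Sum>j\<in>{1..n}. C * y j t)"
        unfolding sum_distrib_left [symmetric] C_def y_def by (rule score_norm_le) (use n a True p in auto)
      then have "ennreal (score_norm n p a t) \<le> ennreal (\<Sum>j\<in>{1..n}. C * y j t)"
        by (rule ennreal_leI)
      also have "\<dots> = (\<Sum>j\<in>{1..n}. ennreal (C * y j t))"
        using y0 by (intro sum_ennreal [symmetric]) (simp add: C_def)
      also have "\<dots> = (\<Sum>j\<in>{1..n}. ennreal C * ennreal (y j t))"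
        using y0 by (intro sum.cong refl ennreal_mult) (auto simp: C_def)
      finally show ?thesis using True by simp
    qed simp
  qed
  also have "\<dots> = (\<Sum>j\<in>{1..n}. ennreal C * (\<integral>\<^sup>+t. ennreal (y j t) * indicator {0<..} t \<partial>lborel))"
    unfolding y_def by (subst nn_integral_sum) (auto simp: nn_integral_cmult)
  also have "\<dots> = (\<Sum>j\<in>{1..n}. ennreal C * ennreal p)"
    unfolding y_def using nn_integral_score_bound [OF a p] by (intro sum.cong refl) simp
  also have "\<dots> < \<infinity>"
    by (simp add: ennreal_mult_less_top of_nat_less_top)
  finally show ?thesis .
qed

lemma score_norm_mono:
  assumes a: "\<And>j. j \<in> {1..n} \<Longrightarrow> a j > 0" and t: "t > 0" and p: "1 \<le> p" and pq: "p \<le> q"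
  shows "score_norm n p a t \<le> score_norm n q a t"
proof -
  define w where "w z = 1 / 2 ^ n * sign_weight n (\<lambda>j. exp (- a j * t)) (snd z)" for z :: "(nat \<Rightarrow> real) \<times> (nat \<Rightarrow> real)"
  define x where "x z = \<bar>score_sum n a t (fst z) (snd z)\<bar>" for z
  have w0: "w z \<ge> 0" if "z \<in> Omega n \<times> Omega n" for z
    unfolding w_def using that sign_weight_heat_nonneg [of n a t, OF a t] by auto
  have norm: "score_norm n r a t = (\<Sum>z\<in>Omega n \<times> Omega n. w z * x z powr r) powr (1 / r)" for r
    unfolding score_norm_def w_def x_def sum_distrib_left sum.cartesian_product split_beta
    by (simp add: mult.assoc)
  have one: "(\<Sum>z\<in>Omega n \<times> Omega n. w z) = 1"
  proof -
    have "(\<Sum>z\<in>Omega n \<times> Omega n. sign_weight n (\<lambda>j. exp (- a j * t)) (snd z)) = 2 ^ n"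
    proof -
      have "(\<Sum>z\<in>Omega n \<times> Omega n. sign_weight n (\<lambda>j. exp (- a j * t)) (snd z))
          = (\<Sum>\<delta>\<in>Omega n. \<Sum>\<xi>\<in>Omega n. sign_weight n (\<lambda>j. exp (- a j * t)) \<xi>)"
        by (subst sum.cartesian_product) (simp add: split_beta)
      then show ?thesis by (simp add: sum_sign_weight card_Omega)
    qed
    then show ?thesis unfolding w_def sum_distrib_left [symmetric] by (simp only:) simp
  qed
  have "(\<Sum>z\<in>Omega n \<times> Omega n. w z * x z powr p) powr (q / p)
      \<le> (\<Sum>z\<in>Omega n \<times> Omega n. w z * (x z powr p) powr (q / p))"
    using p pq w0 one by (intro weighted_mean_powr_le) auto
  also have "\<dots> = (\<Sum>z\<in>Omega n \<times> Omega n. w z * x z powr q)"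
    using p by (simp add: powr_powr)
  finally have "((\<Sum>z\<in>Omega n \<times> Omega n. w z * x z powr p) powr (q / p)) powr (1 / q)
      \<le> (\<Sum>z\<in>Omega n \<times> Omega n. w z * x z powr q) powr (1 / q)"
    using p pq by (intro powr_mono2) auto
  then show ?thesis using p pq by (simp add: norm powr_powr)
qed

lemma Lambda_mono:
  assumes a: "\<And>j. j \<in> {1..n} \<Longrightarrow> a j > 0" and p: "1 \<le> p" "p \<le> q"
  shows "Lambda n p a \<le> Lambda n q a"
proof -
  have L: "Lambda n r a = (\<integral>\<^sup>+t\<in>{0<..}. ennreal (score_norm n r a t) \<partial>lborel)" for r
    by (rule Lambda_eq_score_norm) (rule a)
  show ?thesis
    unfolding L
  proof (intro nn_integral_mono)
    fix t :: real
    show "ennreal (score_norm n p a t) * indicator {0<..} t \<le> ennreal (score_norm n q a t) * indicator {0<..} t"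
      using score_norm_mono [of n a t p q, OF a _ p] by (auto simp: indicator_def intro: ennreal_leI)
  qed
qed

section \<open>The constant for the exponent two\<close>
text \<open>Since the second score is an affine function of \<open>\<xi>\<^sub>j\<close>, the correlations of the first score with
  \<open>W\<^sub>\<emptyset>\<close> and with \<open>W\<^bsub>{j}\<^esub>\<close> suffice.\<close>
lemma score_orthogonal:
  assumes a: "\<And>j. j \<in> {1..n} \<Longrightarrow> a j > 0" and t: "t > 0" and i: "i \<in> {1..n}" and j: "j \<in> {1..n}"
  shows "(\<Sum>\<xi>\<in>Omega n. sign_weight n (\<lambda>j. exp (- a j * t)) \<xi> * (score a t i (\<xi> i) * score a t j (\<xi> j)))
    = (if i = j then (a j)\<^sup>2 / (exp (2 * a j * t) - 1) else 0)"
proof -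
  define w where "w \<xi> = sign_weight n (\<lambda>j. exp (- a j * t)) \<xi>" for \<xi>
  define m where "m = exp (- a j * t)"
  have m: "0 < m" "1 - m\<^sup>2 > 0" using exp_neg_bounds [OF a [OF j] t] by (auto simp: m_def)
  have E1: "(\<Sum>\<xi>\<in>Omega n. w \<xi> * score a t i (\<xi> i)) = 0"
    using score_walsh_correlation [of n a t i "{}", OF a t i] by (simp add: walsh_def w_def)
  have E2: "(\<Sum>\<xi>\<in>Omega n. w \<xi> * (score a t i (\<xi> i) * \<xi> j)) = (if i = j then a j * m else 0)"
    using score_walsh_correlation [of n a t i "{j}", OF a t i] j by (simp add: walsh_def w_def m_def mult.commute)
  have "(\<Sum>\<xi>\<in>Omega n. w \<xi> * (score a t i (\<xi> i) * score a t j (\<xi> j)))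
      = (\<Sum>\<xi>\<in>Omega n. a j * m / (1 - m\<^sup>2) * (w \<xi> * (score a t i (\<xi> i) * \<xi> j) - m * (w \<xi> * score a t i (\<xi> i))))"
    unfolding score_def [of a t j] m_def [symmetric] by (intro sum.cong refl) (simp add: algebra_simps diff_divide_distrib add_divide_distrib)
  also have "\<dots> = a j * m / (1 - m\<^sup>2) * (if i = j then a j * m else 0)"
    unfolding sum_distrib_left [symmetric] sum_subtractf E1 E2 by simp
  also have "\<dots> = (if i = j then (a j)\<^sup>2 / (exp (2 * a j * t) - 1) else 0)"
  proof -
    have "exp (2 * a j * t) = 1 / m\<^sup>2"
      by (simp add: m_def power2_eq_square exp_add [symmetric] exp_minus [symmetric] divide_inverse)
    moreover have "(a j)\<^sup>2 / (1 / m\<^sup>2 - 1) = a j * m / (1 - m\<^sup>2) * (a j * m)"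
      using m by (simp add: divide_simps power2_eq_square)
    ultimately show ?thesis by simp
  qed
  finally show ?thesis by (simp only: w_def)
qed

lemma score_norm_2:
  assumes a: "\<And>j. j \<in> {1..n} \<Longrightarrow> a j > 0" and t: "t > 0"
  shows "score_norm n 2 a t = sqrt (\<Sum>j\<in>{1..n}. (a j)\<^sup>2 / (exp (2 * a j * t) - 1))"
proof -
  define w where "w \<xi> = sign_weight n (\<lambda>j. exp (- a j * t)) \<xi>" for \<xi>
  define V where "V = (\<Sum>j\<in>{1..n}. (a j)\<^sup>2 / (exp (2 * a j * t) - 1))"
  have "V \<ge> 0" unfolding V_def using a t by (intro sum_nonneg divide_nonneg_nonneg) (auto simp: less_imp_le)
  have "(\<Sum>\<xi>\<in>Omega n. w \<xi> * \<bar>score_sum n a t \<delta> \<xi>\<bar> powr 2) = V" if \<delta>: "\<delta> \<in> Omega n" for \<delta>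
  proof -
    have "(\<Sum>\<xi>\<in>Omega n. w \<xi> * \<bar>score_sum n a t \<delta> \<xi>\<bar> powr 2)
        = (\<Sum>\<xi>\<in>Omega n. \<Sum>i\<in>{1..n}. \<Sum>j\<in>{1..n}. \<delta> i * \<delta> j * (w \<xi> * (score a t i (\<xi> i) * score a t j (\<xi> j))))"
    proof (intro sum.cong refl)
      fix \<xi>
      have "\<bar>score_sum n a t \<delta> \<xi>\<bar> powr 2 = score_sum n a t \<delta> \<xi> * score_sum n a t \<delta> \<xi>"
        by (simp add: power2_eq_square)
      then show "w \<xi> * \<bar>score_sum n a t \<delta> \<xi>\<bar> powr 2
        = (\<Sum>i\<in>{1..n}. \<Sum>j\<in>{1..n}. \<delta> i * \<delta> j * (w \<xi> * (score a t i (\<xi> i) * score a t j (\<xi> j))))"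
        unfolding score_sum_def sum_product by (simp add: sum_distrib_left mult_ac)
    qed
    also have "\<dots> = (\<Sum>i\<in>{1..n}. \<Sum>\<xi>\<in>Omega n. \<Sum>j\<in>{1..n}. \<delta> i * \<delta> j * (w \<xi> * (score a t i (\<xi> i) * score a t j (\<xi> j))))"
      by (rule sum.swap)
    also have "\<dots> = (\<Sum>i\<in>{1..n}. \<Sum>j\<in>{1..n}. \<Sum>\<xi>\<in>Omega n. \<delta> i * \<delta> j * (w \<xi> * (score a t i (\<xi> i) * score a t j (\<xi> j))))"
      by (intro sum.cong refl sum.swap)
    also have "\<dots> = (\<Sum>i\<in>{1..n}. \<Sum>j\<in>{1..n}. if i = j then (a j)\<^sup>2 / (exp (2 * a j * t) - 1) else 0)"
    proof (intro sum.cong refl)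
      fix i j assume ij: "i \<in> {1..n}" "j \<in> {1..n}"
      have "(\<Sum>\<xi>\<in>Omega n. \<delta> i * \<delta> j * (w \<xi> * (score a t i (\<xi> i) * score a t j (\<xi> j))))
          = \<delta> i * \<delta> j * (if i = j then (a j)\<^sup>2 / (exp (2 * a j * t) - 1) else 0)"
        unfolding sum_distrib_left [symmetric] w_def by (subst score_orthogonal) (use a t ij in auto)
      then show "(\<Sum>\<xi>\<in>Omega n. \<delta> i * \<delta> j * (w \<xi> * (score a t i (\<xi> i) * score a t j (\<xi> j))))
          = (if i = j then (a j)\<^sup>2 / (exp (2 * a j * t) - 1) else 0)"
        using Omega_values [OF \<delta> ij(1)] by auto
    qed
    also have "\<dots> = V" unfolding V_def by (intro sum.cong refl) simp
    finally show ?thesis .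
  qed
  then have "score_norm n 2 a t = (\<Sum>\<delta>\<in>Omega n. 1 / 2 ^ n * V) powr (1 / 2)"
    unfolding score_norm_def w_def [symmetric] by simp
  also have "\<dots> = V powr (1 / 2)" by (simp add: card_Omega)
  finally show ?thesis using \<open>V \<ge> 0\<close> by (simp add: V_def powr_half_sqrt)
qed

lemma Lambda_2:
  assumes a: "\<And>j. j \<in> {1..n} \<Longrightarrow> a j > 0"
  shows "Lambda n 2 a =
      (\<integral>\<^sup>+t\<in>{0<..}. ennreal (sqrt (\<Sum>j\<in>{1..n}. (a j)\<^sup>2 / (exp (2 * a j * t) - 1))) \<partial>lborel)"
proof -
  have "Lambda n 2 a = (\<integral>\<^sup>+t\<in>{0<..}. ennreal (score_norm n 2 a t) \<partial>lborel)"
    by (rule Lambda_eq_score_norm) (rule a)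
  also have "\<dots> = (\<integral>\<^sup>+t\<in>{0<..}. ennreal (sqrt (\<Sum>j\<in>{1..n}. (a j)\<^sup>2 / (exp (2 * a j * t) - 1))) \<partial>lborel)"
  proof (intro nn_integral_cong)
    fix t :: real
    show "ennreal (score_norm n 2 a t) * indicator {0<..} t
        = ennreal (sqrt (\<Sum>j\<in>{1..n}. (a j)\<^sup>2 / (exp (2 * a j * t) - 1))) * indicator {0<..} t"
    proof (cases "t > 0")
      case True
      have "score_norm n 2 a t = sqrt (\<Sum>j\<in>{1..n}. (a j)\<^sup>2 / (exp (2 * a j * t) - 1))"
        by (rule score_norm_2) (use a True in auto)
      then show ?thesis by (simp only:)
    qed simp
  qed
  finally show ?thesis .
qed

lemma nn_integral_inverse_sqrt_exp:
  fixes c K :: real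
  assumes c: "c > 0" and K: "K \<ge> 0"
  shows "(\<integral>\<^sup>+t\<in>{0<..}. ennreal (K * (c / sqrt (exp (2 * c * t) - 1))) \<partial>lborel) = ennreal (K * (pi / 2))"
proof -
  have pos: "exp (2 * c * t) - 1 > 0" if "t > 0" for t using c that by simp
  have "(\<integral>\<^sup>+t\<in>{0<..}. ennreal (K * (c / sqrt (exp (2 * c * t) - 1))) \<partial>lborel) = ennreal (K * (pi / 2) - K * 0)"
  proof (rule nn_integral_FTC_greaterThan_0 [where F = "\<lambda>t. K * arctan (sqrt (exp (2 * c * t) - 1))"])
    fix t :: real assume t: "t > 0"
    define s where "s = sqrt (exp (2 * c * t) - 1)"
    have s: "s > 0" "1 + s\<^sup>2 = exp (2 * c * t)" using pos [OF t] by (auto simp: s_def)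
    have "((\<lambda>t. K * arctan (sqrt (exp (2 * c * t) - 1))) has_real_derivative
        K * (inverse (1 + s\<^sup>2) * (inverse s / 2 * (exp (2 * c * t) * (2 * c))))) (at t)"
      unfolding s_def using pos [OF t] by (auto intro!: derivative_eq_intros)
    also have "K * (inverse (1 + s\<^sup>2) * (inverse s / 2 * (exp (2 * c * t) * (2 * c)))) = K * (c / s)"
      unfolding s(2) by (simp add: field_simps)
    finally show "((\<lambda>t. K * arctan (sqrt (exp (2 * c * t) - 1))) has_real_derivative
        K * (c / sqrt (exp (2 * c * t) - 1))) (at t)" by (simp only: s_def)
    show "isCont (\<lambda>t. K * (c / sqrt (exp (2 * c * t) - 1))) t"
      using pos [OF t] by (intro continuous_intros) auto
    show "0 \<le> K * (c / sqrt (exp (2 * c * t) - 1))" using c K pos [OF t] by simp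
  next
    have "((\<lambda>t. K * arctan (sqrt (exp (2 * c * t) - 1))) \<longlongrightarrow> K * arctan (sqrt (exp (2 * c * 0) - 1))) (at_right 0)"
      by (intro tendsto_intros)
    then show "((\<lambda>t. K * arctan (sqrt (exp (2 * c * t) - 1))) \<longlongrightarrow> K * 0) (at_right 0)" by simp
  next
    have "LIM t at_top. (2 * c) * t :> at_top"
      by (rule filterlim_tendsto_pos_mult_at_top [OF tendsto_const _ filterlim_ident]) (use c in simp)
    then have "LIM t at_top. - 1 + exp (2 * c * t) :> at_top"
      by (intro filterlim_tendsto_add_at_top [OF tendsto_const] filterlim_compose [OF exp_at_top])
    then have "LIM t at_top. sqrt (exp (2 * c * t) - 1) :> at_top"
      by (intro filterlim_compose [OF sqrt_at_top]) simp
    then have "((\<lambda>t. arctan (sqrt (exp (2 * c * t) - 1))) \<longlongrightarrow> pi / 2) at_top"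
      by (rule filterlim_compose [OF tendsto_arctan_at_top])
    then show "((\<lambda>t. K * arctan (sqrt (exp (2 * c * t) - 1))) \<longlongrightarrow> K * (pi / 2)) at_top"
      by (intro tendsto_intros)
  qed
  then show ?thesis by simp
qed

lemma Lambda_2_const:
  assumes n: "n \<ge> 1" and a: "\<And>j. j \<in> {1..n} \<Longrightarrow> a j > 0"
    and eq: "\<And>i j. i \<in> {1..n} \<Longrightarrow> j \<in> {1..n} \<Longrightarrow> a i = a j"
  shows "Lambda n 2 a = ennreal (pi / 2 * sqrt (real n))"
proof -
  define c where "c = a 1"
  have one: "1 \<in> {1..n}" using n by simp
  have c: "c > 0" unfolding c_def by (rule a [OF one])
  have ac: "a j = c" if "j \<in> {1..n}" for j unfolding c_def by (rule eq [OF that one])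
  have "sqrt (\<Sum>j\<in>{1..n}. (a j)\<^sup>2 / (exp (2 * a j * t) - 1)) = sqrt (real n) * (c / sqrt (exp (2 * c * t) - 1))" for t
  proof -
    have "(\<Sum>j\<in>{1..n}. (a j)\<^sup>2 / (exp (2 * a j * t) - 1)) = (\<Sum>j\<in>{1..n}. c\<^sup>2 / (exp (2 * c * t) - 1))"
      by (intro sum.cong refl) (simp only: ac)
    also have "\<dots> = real n * (c\<^sup>2 / (exp (2 * c * t) - 1))" by simp
    finally show ?thesis using c by (simp add: real_sqrt_mult real_sqrt_divide)
  qed
  then have "Lambda n 2 a = (\<integral>\<^sup>+t\<in>{0<..}. ennreal (sqrt (real n) * (c / sqrt (exp (2 * c * t) - 1))) \<partial>lborel)"
    using Lambda_2 [of n a] a by (simp only:)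
  then show ?thesis using nn_integral_inverse_sqrt_exp [OF c, of "sqrt (real n)"] by (simp add: mult.commute)
qed

section \<open>The bound for the Riesz transforms\<close>

theorem theorem3p5:
  fixes n :: nat and a :: "nat \<Rightarrow> real"
  assumes "n \<ge> 1" and "\<And>j. j \<in> {1..n} \<Longrightarrow> a j > 0"
  shows "(\<forall>p\<ge>1. Lambda n p a < \<infinity>) \<and>
    (\<forall>p\<ge>1. \<forall>g :: (nat \<Rightarrow> real) \<Rightarrow> 'x::banach.
      ennreal ((measure_pmf.expectation (pair_pmf (pmf_of_set (Omega n)) (rademacher_pmf n))
          (\<lambda>(\<epsilon>, \<delta>). norm (\<Sum>j\<in>{1..n}. \<delta> j *\<^sub>R a j *\<^sub>R Delta_inv n a (D_op n j g) \<epsilon>) powr p))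
        powr (1 / p))
      \<le> Lambda n p a * ennreal (Lp_norm n p g)) \<and>
    (\<forall>p. 1 \<le> p \<and> p \<le> 2 \<longrightarrow> Lambda n p a \<le> Lambda n 2 a) \<and>
    Lambda n 2 a =
      (\<integral>\<^sup>+t\<in>{0<..}. ennreal (sqrt (\<Sum>j\<in>{1..n}. (a j)\<^sup>2 / (exp (2 * a j * t) - 1))) \<partial>lborel) \<and>
    ((\<forall>i\<in>{1..n}. \<forall>j\<in>{1..n}. a i = a j) \<longrightarrow> Lambda n 2 a = ennreal (pi / 2 * sqrt (real n)))"
proof (intro conjI allI impI)
  fix p :: real assume "1 \<le> p"
  then show "Lambda n p a < \<infinity>" using Lambda_finite assms by blast
next
  fix p :: real and g :: "(nat \<Rightarrow> real) \<Rightarrow> 'x"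
  assume "1 \<le> p"
  with assms(2) show "ennreal ((measure_pmf.expectation (pair_pmf (pmf_of_set (Omega n)) (rademacher_pmf n))
          (\<lambda>(\<epsilon>, \<delta>). norm (\<Sum>j\<in>{1..n}. \<delta> j *\<^sub>R a j *\<^sub>R Delta_inv n a (D_op n j g) \<epsilon>) powr p))
        powr (1 / p))
      \<le> Lambda n p a * ennreal (Lp_norm n p g)"
    by (rule Riesz_transform_bound)
next
  fix p :: real assume "1 \<le> p \<and> p \<le> 2"
  with assms(2) show "Lambda n p a \<le> Lambda n 2 a" by (intro Lambda_mono) auto
next
  show "Lambda n 2 a =
      (\<integral>\<^sup>+t\<in>{0<..}. ennreal (sqrt (\<Sum>j\<in>{1..n}. (a j)\<^sup>2 / (exp (2 * a j * t) - 1))) \<partial>lborel)"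
    using assms(2) by (rule Lambda_2)
next
  assume "\<forall>i\<in>{1..n}. \<forall>j\<in>{1..n}. a i = a j"
  then show "Lambda n 2 a = ennreal (pi / 2 * sqrt (real n))"
    using assms by (intro Lambda_2_const) blast+
qed

end
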